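(* For a long virtual knot $K$, we have the following, where primes denote derivatives with respect to $t$. (i) $W_0'(K;1)=W_1'(K;1)$. (ii) $G_{00}'(K;1)=G_{11}'(K;1)=0$. (iii) $G_{01}'(K;1)+G_{10}'(K;1)=0$. (iv) $F_{01}'(K;1)=H_{01}'(K;1)$ and $F_{10}'(K;1)=H_{10}'(K;1)$. (v) $F_{00}''(K;1)+F_{11}''(K;1)+H_{00}''(K;1)+H_{11}''(K;1)\equiv0\pmod 4$.
   Context: A long virtual knot diagram is an immersed line in $\mathbb{R}^2$ that agrees with the $x$-axis outside some $2$-disk and has finitely many transversal double points, each being either a real crossing (with over/under information) or a virtual crossing (without it); it is oriented from $-\infty$ to $\infty$. A long virtual knot is an equivalence class of such diagrams under generalized Reidemeister moves (the classical moves I, II, III on real crossings, the three analogous moves on virtual crossings, and the mixed move passing a strand having only virtual crossings across a real crossing). Let $D$ be a diagram of a long virtual knot $K$ with real crossings $c_1,\dots,c_n$, and let $\varepsilon_i\in\{1,-1\}$ be the sign of $c_i$. The crossing $c_i$ is of type $0$ if, travelling along $D$ from $-\infty$ to $\infty$, one passes $c_i$ first over and then under; otherwise it is of type $1$. For $a\in\{0,1\}$ put $I_a=\{i\mid c_i\text{ is of type }a\}$ and $\omega_a=\sum_{i\in I_a}\varepsilon_i$. A surface realization of $D$ is a closed, connected, oriented surface $\Sigma_g$ together with an oriented knot diagram on $\Sigma_g$ with a basepoint and with no virtual crossings, whose real crossings coincide with those of $D$ (same order of passage, over/under information and signs), and whose basepoint corresponds to $\pm\infty$ of $D$. Smoothing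 this diagram at $c_i$ (respecting orientation) gives two oriented loops on $\Sigma_g$: $\alpha_i$ is the one not containing the basepoint and $\beta_i$ is the one containing it; they are regarded as homology cycles on $\Sigma_g$. The intersection numbers $\gamma\cdot\gamma'\in\mathbb{Z}$ of such cycles are independent of the choice of surface realization. Put $W_a(K;t)=\sum_{i\in I_a}\varepsilon_i(t^{\alpha_i\cdot\beta_i}-1)$ and, for $a,b\in\{0,1\}$, \[F_{ab}(K;t)=\sum_{i\in I_a,\,j\in I_b}\varepsilon_i\varepsilon_j(t^{\alpha_i\cdot\alpha_j}-1),\] \[G_{ab}(K;t)=\sum_{i\in I_a,\,j\in I_b}\varepsilon_i\varepsilon_j(t^{\alpha_i\cdot\beta_j}-1)-\omega_bW_a(K;t),\] \[H_{ab}(K;t)=\sum_{i\in I_a,\,j\in I_b}\varepsilon_i\varepsilon_j(t^{\beta_i\cdot\beta_j}-1)-\omega_aW_b(K;t)-\omega_bW_a(K;t^{-1}).\] These Laurent polynomials in $\mathbb{Z}[t,t^{-1}]$ depend only on $K$, not on $D$. For $Y$ any of them, $Y'(K;1)$ and $Y''(K;1)$ denote the values at $t=1$ of the first and second derivatives of $Y(K;t)$ with respect to $t$. *)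

theory Defs
  imports "HOL-Analysis.Analysis" "HOL-Homology.Homology"
begin

section \<open>Long virtual knot diagrams\<close>

text \<open>
  An immersed curve is a regular parametrised curve.  Its double points are recorded by the ordered
  pairs \<open>(s, t)\<close> of distinct parameters with the same image, so every double point occurs
  twice, as \<open>(s, t)\<close> and as \<open>(t, s)\<close>.
\<close>

definition immersed :: "(real \<Rightarrow> 'a::real_normed_vector) \<Rightarrow> bool" where
  "immersed f \<longleftrightarrow> f C1_differentiable_on UNIV \<and> (\<forall>t. vector_derivative f (at t) \<noteq> 0)"

definition double_pairs :: "real set \<Rightarrow> (real \<Rightarrow> 'a) \<Rightarrow> (real \<times> real) set" where
  "double_pairs T f = {(s, t). s \<in> T \<and> t \<in> T \<and> s \<noteq> t \<and> f s = f t}"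

definition transversal_double_points :: "real set \<Rightarrow> (real \<Rightarrow> 'a::real_normed_vector) \<Rightarrow> bool" where
  "transversal_double_points T f \<longleftrightarrow>
     finite (double_pairs T f) \<and>
     (\<forall>s t t'. (s, t) \<in> double_pairs T f \<and> (s, t') \<in> double_pairs T f \<longrightarrow> t = t') \<and>
     (\<forall>(s, t) \<in> double_pairs T f. \<forall>x y :: real.
        x *\<^sub>R vector_derivative f (at s) + y *\<^sub>R vector_derivative f (at t) = 0 \<longrightarrow> x = 0 \<and> y = 0)"

text \<open>
  A real crossing is the pair (parameter of the over-passage, parameter of the under-passage).
  A double point of the line for which neither ordered pair is listed is a virtual crossing.
\<close>

definition crossing_information :: "(real \<times> real) set \<Rightarrow> (real \<times> real) set \<Rightarrow> bool" where
  "crossing_information P C \<longleftrightarrow> C \<subseteq> P \<and> (\<forall>s t. (s, t) \<in> C \<longrightarrow> (t, s) \<notin> C)"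

record long_diagram =
  line :: "real \<Rightarrow> real^2"
  crossings :: "(real \<times> real) set"

definition long_virtual_knot_diagram :: "long_diagram \<Rightarrow> bool" where
  "long_virtual_knot_diagram D \<longleftrightarrow>
     immersed (line D) \<and>
     (\<exists>r. (\<forall>t. \<bar>t\<bar> > r \<longrightarrow> line D t = vector [t, 0]) \<and> (\<forall>t. \<bar>t\<bar> \<le> r \<longrightarrow> norm (line D t) \<le> r)) \<and>
     transversal_double_points UNIV (line D) \<and>
     crossing_information (double_pairs UNIV (line D)) (crossings D)"

definition sgn_int :: "real \<Rightarrow> int" where
  "sgn_int x = (if x > 0 then 1 else if x < 0 then -1 else 0)"

text \<open>
  A crossing is positive if (over-tangent, under-tangent) is a positively oriented basis.
\<close>

definition crossing_sign :: "long_diagram \<Rightarrow> real \<times> real \<Rightarrow> int" where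
  "crossing_sign D c =
     (let p = vector_derivative (line D) (at (fst c)); q = vector_derivative (line D) (at (snd c))
      in sgn_int (p$1 * q$2 - p$2 * q$1))"

definition crossing_type :: "real \<times> real \<Rightarrow> nat" where
  "crossing_type c = (if fst c < snd c then 0 else 1)"

definition crossings_of_type :: "long_diagram \<Rightarrow> nat \<Rightarrow> (real \<times> real) set" where
  "crossings_of_type D a = {c \<in> crossings D. crossing_type c = a}"

definition writhe :: "long_diagram \<Rightarrow> nat \<Rightarrow> int" where
  "writhe D a = (\<Sum>c \<in> crossings_of_type D a. crossing_sign D c)"


section \<open>Long virtual knots\<close>

text \<open>
  Diagrams are considered up to reparametrisation and ambient isotopy of the plane.  A compactly
  supported homeomorphism of the plane is isotopic to the identity (Alexander trick).
\<close>

definition plane_equivalent :: "long_diagram \<Rightarrow> long_diagram \<Rightarrow> bool" where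
  "plane_equivalent D D' \<longleftrightarrow>
     (\<exists>\<phi> \<psi> h. homeomorphism UNIV UNIV \<phi> \<psi> \<and> bounded {x. \<phi> x \<noteq> x} \<and>
        strict_mono h \<and> surj h \<and>
        (\<forall>t. line D' (h t) = \<phi> (line D t)) \<and> crossings D' = map_prod h h ` crossings D)"

text \<open>
  A local replacement changes a diagram only inside a disk \<open>B\<close>, which the line meets in the
  \<open>k\<close> proper arcs parametrised by the disjoint intervals \<open>[l i, u i]\<close>.
\<close>

definition local_replacement ::
    "long_diagram \<Rightarrow> long_diagram \<Rightarrow> nat \<Rightarrow> (nat \<Rightarrow> real) \<Rightarrow> (nat \<Rightarrow> real) \<Rightarrow> bool" where
  "local_replacement D D' k l u \<longleftrightarrow>
     (\<forall>i<k. l i < u i) \<and> disjoint_family_on (\<lambda>i. {l i..u i}) {..<k} \<and>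
     (\<exists>B. B homeomorphic cball (0::real^2) 1 \<and>
        (\<forall>E \<in> {D, D'}. line E -` B = (\<Union>i<k. {l i..u i}) \<and>
                       line E -` interior B = (\<Union>i<k. {l i<..<u i}))) \<and>
     (\<forall>t. t \<notin> (\<Union>i<k. {l i..u i}) \<longrightarrow> line D t = line D' t) \<and>
     (let J = (\<Union>i<k. {l i..u i}) in crossings D - J \<times> J = crossings D' - J \<times> J)"

definition arc_doubles ::
    "long_diagram \<Rightarrow> (nat \<Rightarrow> real) \<Rightarrow> (nat \<Rightarrow> real) \<Rightarrow> nat \<Rightarrow> nat \<Rightarrow> (real \<times> real) set" where
  "arc_doubles D l u i j = double_pairs UNIV (line D) \<inter> {l i..u i} \<times> {l j..u j}"

definition arc_crossings ::
    "long_diagram \<Rightarrow> (nat \<Rightarrow> real) \<Rightarrow> (nat \<Rightarrow> real) \<Rightarrow> nat \<Rightarrow> nat \<Rightarrow> (real \<times> real) set" where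
  "arc_crossings D l u i j = crossings D \<inter> {l i..u i} \<times> {l j..u j}"

text \<open>
  Move I: a simple arc is exchanged for an arc with one double point (which appears as two ordered
  pairs), real or virtual.
\<close>

definition move_I :: "long_diagram \<Rightarrow> long_diagram \<Rightarrow> bool" where
  "move_I D D' \<longleftrightarrow>
     (\<exists>l u. local_replacement D D' 1 l u \<and>
        arc_doubles D l u 0 0 = {} \<and> card (arc_doubles D' l u 0 0) = 2)"

text \<open>
  Move II: two disjoint simple arcs are exchanged for two simple arcs which meet in two double points,
  either both real with the same arc on top, or both virtual.
\<close>

definition move_II :: "long_diagram \<Rightarrow> long_diagram \<Rightarrow> bool" where
  "move_II D D' \<longleftrightarrow>
     (\<exists>l u. local_replacement D D' 2 l u \<and>
        (\<forall>i<2. \<forall>j<2. arc_doubles D l u i j = {}) \<and>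
        (\<forall>i<2. arc_doubles D' l u i i = {}) \<and>
        card (arc_doubles D' l u 0 1) = 2 \<and>
        (arc_crossings D' l u 0 1 = arc_doubles D' l u 0 1 \<or>
         arc_crossings D' l u 1 0 = arc_doubles D' l u 1 0 \<or>
         arc_crossings D' l u 0 1 = {} \<and> arc_crossings D' l u 1 0 = {}))"

text \<open>
  Move III: three simple arcs which pairwise meet in exactly one double point.  Up to isotopy there are
  two such configurations with given end points in a disk, namely the two sides of the move.  The
  relation \<open>i\<close> passes over \<open>j\<close> at a real crossing is the same on both sides.  The three
  shapes of this relation are the classical move (top, middle and bottom arc), the purely virtual move,
  and the mixed move, where the arc \<open>r\<close> has only virtual crossings.
\<close>

definition over_relation ::
    "long_diagram \<Rightarrow> (nat \<Rightarrow> real) \<Rightarrow> (nat \<Rightarrow> real) \<Rightarrow> (nat \<times> nat) set" where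
  "over_relation D l u = {(i, j). i < 3 \<and> j < 3 \<and> arc_crossings D l u i j \<noteq> {}}"

definition move_III :: "long_diagram \<Rightarrow> long_diagram \<Rightarrow> bool" where
  "move_III D D' \<longleftrightarrow>
     (\<exists>l u. local_replacement D D' 3 l u \<and>
        (\<forall>E \<in> {D, D'}. \<forall>i<3. \<forall>j<3. card (arc_doubles E l u i j) = (if i = j then 0 else 1)) \<and>
        over_relation D l u = over_relation D' l u \<and>
        (\<exists>p q r. {p, q, r} = {0, 1, 2} \<and>
           (over_relation D l u = {(p, q), (p, r), (q, r)} \<or>
            over_relation D l u = {} \<or>
            over_relation D l u = {(p, q)})))"

definition elementary_move :: "long_diagram \<Rightarrow> long_diagram \<Rightarrow> bool" where
  "elementary_move D D' \<longleftrightarrow>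
     long_virtual_knot_diagram D \<and> long_virtual_knot_diagram D' \<and>
     (plane_equivalent D D' \<or> move_I D D' \<or> move_II D D' \<or> move_III D D')"

definition long_virtual_knots :: "long_diagram set set" where
  "long_virtual_knots =
     Collect long_virtual_knot_diagram //
       {(D, D'). long_virtual_knot_diagram D \<and> long_virtual_knot_diagram D' \<and>
                 equivclp elementary_move D D'}"


section \<open>Oriented surfaces and their intersection form\<close>

text \<open>
  Every closed connected oriented surface embeds smoothly in \<open>\<real>\<^sup>3\<close>, so we use embedded surfaces.
  The orientation is given by the unit normal field \<open>N\<close>: tangent vectors \<open>(v, w)\<close> form
  a positive basis at \<open>x\<close> iff \<open>det (N x, v, w) > 0\<close>.
\<close>

definition closed_oriented_surface :: "(real^3) set \<Rightarrow> (real^3 \<Rightarrow> real^3) \<Rightarrow> bool" where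
  "closed_oriented_surface S N \<longleftrightarrow>
     compact S \<and> connected S \<and> S \<noteq> {} \<and>
     (\<forall>x \<in> S. \<exists>U (f :: real^3 \<Rightarrow> real) g.
        open U \<and> x \<in> U \<and> continuous_on U g \<and>
        (\<forall>y \<in> U. GDERIV f y :> g y \<and> g y \<noteq> 0) \<and>
        S \<inter> U = {y \<in> U. f y = 0} \<and>
        (\<forall>y \<in> S \<inter> U. N y = g y /\<^sub>R norm (g y)))"

definition local_intersection_sign ::
    "(real^3 \<Rightarrow> real^3) \<Rightarrow> (real \<Rightarrow> real^3) \<Rightarrow> (real \<Rightarrow> real^3) \<Rightarrow> real \<Rightarrow> real \<Rightarrow> int" where
  "local_intersection_sign N p q s t =
     sgn_int (N (p s) \<bullet> cross3 (vector_derivative p (at s)) (vector_derivative q (at t)))"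

abbreviation loop_in :: "(real^3) set \<Rightarrow> (real \<Rightarrow> real^3) \<Rightarrow> bool" where
  "loop_in S p \<equiv> path p \<and> path_image p \<subseteq> S \<and> pathfinish p = pathstart p"

text \<open>The class in \<open>H\<^sub>1(S; \<int>)\<close> of a loop, viewed as a singular 1-cycle.\<close>

definition loop_class :: "(real^3) set \<Rightarrow> (real \<Rightarrow> real^3) \<Rightarrow> (real^3) chain set" where
  "loop_class S p =
     homologous_rel_set 1 (top_of_set S) {} (frag_of (restrict (\<lambda>x. p (x 1)) (standard_simplex 1)))"

definition intersection_pairs :: "(real \<Rightarrow> real^3) \<Rightarrow> (real \<Rightarrow> real^3) \<Rightarrow> (real \<times> real) set" where
  "intersection_pairs p q = {(s, t). s \<in> {0..1} \<and> t \<in> {0..1} \<and> p s = q t}"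

definition meet_transversally ::
    "(real^3 \<Rightarrow> real^3) \<Rightarrow> (real \<Rightarrow> real^3) \<Rightarrow> (real \<Rightarrow> real^3) \<Rightarrow> bool" where
  "meet_transversally N p q \<longleftrightarrow>
     finite (intersection_pairs p q) \<and>
     (\<forall>(s, t) \<in> intersection_pairs p q.
        s \<in> {0<..<1} \<and> t \<in> {0<..<1} \<and> p differentiable (at s) \<and> q differentiable (at t) \<and>
        local_intersection_sign N p q s t \<noteq> 0)"

text \<open>
  The intersection form is the skew-symmetric bilinear form on \<open>H\<^sub>1(S; \<int>)\<close> that counts with
  signs the intersections of transversal loops.  It is uniquely determined by these properties, as
  the first homology is generated by loops and any two loops can be made transversal by a homotopy.
\<close>

definition intersection_form ::
    "(real^3) set \<Rightarrow> (real^3 \<Rightarrow> real^3) \<Rightarrow> ((real^3) chain set \<Rightarrow> (real^3) chain set \<Rightarrow> int) \<Rightarrow> bool" where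
  "intersection_form S N \<iota> \<longleftrightarrow>
     (let H = homology_group 1 (top_of_set S) in
        (\<forall>y \<in> carrier H. (\<lambda>x. \<iota> x y) \<in> hom H integer_group) \<and>
        (\<forall>x \<in> carrier H. \<forall>y \<in> carrier H. \<iota> y x = - \<iota> x y) \<and>
        (\<forall>p q. valid_path p \<and> loop_in S p \<and> valid_path q \<and> loop_in S q \<and> meet_transversally N p q \<longrightarrow>
           \<iota> (loop_class S p) (loop_class S q) =
             (\<Sum>(s, t) \<in> intersection_pairs p q. local_intersection_sign N p q s t)))"


section \<open>Surface realizations\<close>

text \<open>
  The knot diagram on the surface is a closed curve of period 1 with base point \<open>knot 0\<close>.  The
  function \<open>passage\<close> sends the parameter at which the long diagram passes a real crossing to
  the parameter of the corresponding passage on the surface.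
\<close>

record realization =
  surface :: "(real^3) set"
  unit_normal :: "real^3 \<Rightarrow> real^3"
  knot :: "real \<Rightarrow> real^3"
  knot_crossings :: "(real \<times> real) set"
  passage :: "real \<Rightarrow> real"

definition surface_knot_diagram :: "realization \<Rightarrow> bool" where
  "surface_knot_diagram R \<longleftrightarrow>
     closed_oriented_surface (surface R) (unit_normal R) \<and>
     range (knot R) \<subseteq> surface R \<and> (\<forall>t. knot R (t + 1) = knot R t) \<and>
     immersed (knot R) \<and>
     transversal_double_points {0..<1} (knot R) \<and>
     (\<forall>t \<in> {0<..<1}. knot R t \<noteq> knot R 0) \<and>
     crossing_information (double_pairs {0..<1} (knot R)) (knot_crossings R)"

definition no_virtual_crossings :: "realization \<Rightarrow> bool" where
  "no_virtual_crossings R \<longleftrightarrow>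
     (\<forall>(s, t) \<in> double_pairs {0..<1} (knot R). (s, t) \<in> knot_crossings R \<or> (t, s) \<in> knot_crossings R)"

definition surface_realization :: "long_diagram \<Rightarrow> realization \<Rightarrow> bool" where
  "surface_realization D R \<longleftrightarrow>
     surface_knot_diagram R \<and> no_virtual_crossings R \<and>
     strict_mono_on (fst ` crossings D \<union> snd ` crossings D) (passage R) \<and>
     knot_crossings R = map_prod (passage R) (passage R) ` crossings D \<and>
     (\<forall>(s, t) \<in> crossings D. crossing_sign D (s, t) =
        local_intersection_sign (unit_normal R) (knot R) (knot R) (passage R s) (passage R t))"

definition first_passage :: "realization \<Rightarrow> real \<times> real \<Rightarrow> real" where
  "first_passage R c = passage R (min (fst c) (snd c))"

definition second_passage :: "realization \<Rightarrow> real \<times> real \<Rightarrow> real" where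
  "second_passage R c = passage R (max (fst c) (snd c))"

text \<open>
  Smoothing at the crossing \<open>c\<close> cuts the knot into two loops.  The second one runs through the
  base point, at parameter 1.
\<close>

definition alpha :: "realization \<Rightarrow> real \<times> real \<Rightarrow> (real^3) chain set" where
  "alpha R c = loop_class (surface R) (subpath (first_passage R c) (second_passage R c) (knot R))"

definition beta :: "realization \<Rightarrow> real \<times> real \<Rightarrow> (real^3) chain set" where
  "beta R c = loop_class (surface R) (subpath (second_passage R c) (1 + first_passage R c) (knot R))"


section \<open>The writhe polynomial and the intersection polynomials\<close>

text \<open>
  Laurent polynomials are regarded as functions of a real variable \<open>t\<close>.  The argument
  \<open>\<iota>\<close> is the intersection form of the surface.
\<close>

type_synonym pairing = "(real^3) chain set \<Rightarrow> (real^3) chain set \<Rightarrow> int"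

definition W_poly :: "long_diagram \<Rightarrow> realization \<Rightarrow> pairing \<Rightarrow> nat \<Rightarrow> real \<Rightarrow> real" where
  "W_poly D R \<iota> a t =
     (\<Sum>c \<in> crossings_of_type D a.
        of_int (crossing_sign D c) * (t powi \<iota> (alpha R c) (beta R c) - 1))"

definition F_poly :: "long_diagram \<Rightarrow> realization \<Rightarrow> pairing \<Rightarrow> nat \<Rightarrow> nat \<Rightarrow> real \<Rightarrow> real" where
  "F_poly D R \<iota> a b t =
     (\<Sum>c \<in> crossings_of_type D a. \<Sum>d \<in> crossings_of_type D b.
        of_int (crossing_sign D c * crossing_sign D d) * (t powi \<iota> (alpha R c) (alpha R d) - 1))"

definition G_poly :: "long_diagram \<Rightarrow> realization \<Rightarrow> pairing \<Rightarrow> nat \<Rightarrow> nat \<Rightarrow> real \<Rightarrow> real" where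
  "G_poly D R \<iota> a b t =
     (\<Sum>c \<in> crossings_of_type D a. \<Sum>d \<in> crossings_of_type D b.
        of_int (crossing_sign D c * crossing_sign D d) * (t powi \<iota> (alpha R c) (beta R d) - 1))
     - of_int (writhe D b) * W_poly D R \<iota> a t"

definition H_poly :: "long_diagram \<Rightarrow> realization \<Rightarrow> pairing \<Rightarrow> nat \<Rightarrow> nat \<Rightarrow> real \<Rightarrow> real" where
  "H_poly D R \<iota> a b t =
     (\<Sum>c \<in> crossings_of_type D a. \<Sum>d \<in> crossings_of_type D b.
        of_int (crossing_sign D c * crossing_sign D d) * (t powi \<iota> (beta R c) (beta R d) - 1))
     - of_int (writhe D a) * W_poly D R \<iota> b t
     - of_int (writhe D b) * W_poly D R \<iota> a (inverse t)"

end

theory Submission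
  imports Defs
begin

text \<open>
  Write \<open>\<gamma>\<close> for the class of the whole knot, \<open>\<alpha>\<^sub>c\<close> and \<open>\<beta>\<^sub>c\<close> for the two loops obtained by
  smoothing at \<open>c\<close>, and \<open>A\<^sub>a\<close> for the sum of the classes \<open>\<epsilon>\<^sub>c \<alpha>\<^sub>c\<close> over the crossings of type \<open>a\<close>.  Since
  \<open>\<alpha>\<^sub>c + \<beta>\<^sub>c = \<gamma>\<close>, every intersection number in the polynomials is a combination of the skew numbers
  \<open>\<alpha>\<^sub>c \<cdot> \<alpha>\<^sub>d\<close> and of \<open>m\<^sub>c = \<alpha>\<^sub>c \<cdot> \<gamma> = \<alpha>\<^sub>c \<cdot> \<beta>\<^sub>c\<close>.  Differentiating at 1 replaces \<open>t\<^sup>k - 1\<close> by \<open>k\<close>, hence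
  \<open>F\<^sub>a\<^sub>b' = H\<^sub>a\<^sub>b' = A\<^sub>a \<cdot> A\<^sub>b\<close> and \<open>G\<^sub>a\<^sub>b' = - A\<^sub>a \<cdot> A\<^sub>b\<close>; this is (iv), and (ii) and (iii) follow by skew-symmetry.
  The second derivative replaces \<open>t\<^sup>k - 1\<close> by \<open>k (k - 1)\<close>.  For \<open>a = b\<close> the contribution of \<open>F\<close> and \<open>H\<close>
  is, up to a symmetric double sum with vanishing diagonal, which is even and occurs twice, equal
  to \<open>-2 (A\<^sub>a \<cdot> \<gamma>)\<^sup>2\<close> (lemma \<open>second_mod_four\<close>).  As \<open>A\<^sub>0 \<cdot> \<gamma> = A\<^sub>1 \<cdot> \<gamma>\<close> by (i), the total is divisible by 4.

  The geometric content is (i), that is \<open>A\<^sub>0 \<cdot> \<gamma> = A\<^sub>1 \<cdot> \<gamma>\<close>.  If \<open>c\<close> is passed at the times \<open>s < t\<close>, then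
  \<open>\<alpha>\<^sub>c \<cdot> \<beta>\<^sub>c\<close> is the sum of the local signs at the double points that are passed once inside and once
  outside \<open>[s, t]\<close> (lemma \<open>smoothing_intersection\<close>).  Because \<open>\<epsilon>\<^sub>c\<close> is plus or minus the sign of the
  first passage against the second according to the type of \<open>c\<close>, the difference \<open>A\<^sub>0 \<cdot> \<gamma> - A\<^sub>1 \<cdot> \<gamma>\<close> is a
  sum over pairs of linked crossings in which each pair occurs twice with opposite signs (lemma
  \<open>linked_signs_cancel\<close>).

  The loops \<open>\<alpha>\<^sub>c\<close> and \<open>\<beta>\<^sub>c\<close> are not transversal: both have a corner at the crossing \<open>c\<close>.  So \<open>\<alpha>\<^sub>c\<close> is
  replaced by a homologous loop that cuts the corner (lemma \<open>corner_shortcut\<close>).  In a chart of the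
  surface around \<open>c\<close> some line through \<open>c\<close> has the two ends of \<open>\<alpha>\<^sub>c\<close> on one side and the two ends of
  \<open>\<beta>\<^sub>c\<close> on the other, and a straight segment joining the ends of \<open>\<alpha>\<^sub>c\<close> misses \<open>\<beta>\<^sub>c\<close>.
\<close>

section \<open>Homology classes of loops\<close>

text \<open>
  The singular chain underlying \<open>loop_class\<close>, also for paths that are not closed.
\<close>

definition path_chain :: "(real \<Rightarrow> 'a) \<Rightarrow> 'a chain" where
  "path_chain p = frag_of (restrict (\<lambda>x. p (x 1)) (standard_simplex 1))"

abbreviation homologous_in :: "'a::topological_space set \<Rightarrow> 'a chain \<Rightarrow> 'a chain \<Rightarrow> bool" where
  "homologous_in S \<equiv> homologous_rel 1 (top_of_set S) {}"

lemma standard_simplex_1_coord: "x \<in> standard_simplex 1 \<Longrightarrow> x 0 = 1 - x 1"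
  by (auto simp: standard_simplex_def)

lemma standard_simplex_1_range: "x \<in> standard_simplex 1 \<Longrightarrow> x 1 \<in> {0..1}"
  by (auto simp: standard_simplex_def)

lemma singular_simplex_restrict:
  assumes "continuous_on (standard_simplex p) f" "f ` standard_simplex p \<subseteq> S"
  shows "singular_simplex p (top_of_set S) (restrict f (standard_simplex p))"
proof -
  have "continuous_on (standard_simplex p) (restrict f (standard_simplex p))"
    by (rule continuous_on_eq[OF assms(1)]) auto
  then have "continuous_map (subtopology (powertop_real UNIV) (standard_simplex p)) euclidean
               (restrict f (standard_simplex p))"
    by (simp only: euclidean_product_topology continuous_map_iff_continuous)
  then show ?thesis
    using assms(2) unfolding singular_simplex_def continuous_map_in_subtopology by auto
qed

lemma singular_simplex_path:
  assumes "path p" "path_image p \<subseteq> S"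
  shows "singular_simplex 1 (top_of_set S) (restrict (\<lambda>x. p (x 1)) (standard_simplex 1))"
proof -
  have "continuous_on (standard_simplex 1) (\<lambda>x::nat\<Rightarrow>real. x 1)"
    by (rule continuous_on_subset[OF continuous_on_product_coordinates]) simp
  then have "continuous_on (standard_simplex 1) (\<lambda>x. p (x 1))"
    by (rule continuous_on_compose2[OF assms(1)[unfolded path_def]])
       (use standard_simplex_1_range in auto)
  then show ?thesis
    by (rule singular_simplex_restrict) (use assms(2) standard_simplex_1_range in \<open>auto simp: path_image_def\<close>)
qed

lemma singular_cycle_loop:
  assumes "path p" "path_image p \<subseteq> S" "pathfinish p = pathstart p"
  shows "singular_relcycle 1 (top_of_set S) {} (path_chain p)"
proof -
  have eq: "p (simplical_face 0 x 1) = p (simplical_face 1 x 1)" if "x \<in> standard_simplex 0" for x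
    using that assms(3) by (simp add: standard_simplex_0 simplical_face_def pathstart_def pathfinish_def)
  have mem: "simplical_face k x \<in> standard_simplex 1" if "x \<in> standard_simplex 0" "k \<le> 1" for k x
    using simplical_face_in_standard_simplex[of 1 k x] that by simp
  have "singular_face 1 0 (restrict (\<lambda>x. p (x 1)) (standard_simplex 1)) =
        singular_face 1 1 (restrict (\<lambda>x. p (x 1)) (standard_simplex 1))"
    unfolding singular_face_def using eq mem by (auto simp: fun_eq_iff restrict_def)
  then have "chain_boundary 1 (path_chain p) = 0"
    by (simp add: path_chain_def chain_boundary_def atMost_Suc)
  then show ?thesis
    using singular_simplex_path[OF assms(1,2)] by (simp add: singular_cycle singular_chain_of path_chain_def)
qed

text \<open>
  The singular 2-simplex with vertices \<open>a\<close>, \<open>b\<close>, \<open>c\<close> in \<open>C\<close>, mapped by \<open>g\<close>.  All homologies between paths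
  that are needed come from this one, for intervals, squares and plane disks \<open>C\<close>.
\<close>

lemma path_chain_triangle:
  fixes g :: "'b::real_normed_vector \<Rightarrow> 'a::topological_space"
  assumes C: "convex C" and g: "continuous_on C g" "g ` C \<subseteq> S"
    and abc: "a \<in> C" "b \<in> C" "c \<in> C"
  shows "homologous_in S (path_chain (g \<circ> linepath a b) + path_chain (g \<circ> linepath b c))
           (path_chain (g \<circ> linepath a c))"
proof -
  define L where "L = (\<lambda>x::nat \<Rightarrow> real. x 0 *\<^sub>R a + x 1 *\<^sub>R b + x 2 *\<^sub>R c)"
  define \<sigma> where "\<sigma> = restrict (\<lambda>x. g (L x)) (standard_simplex 2)"
  have L_mem: "L x \<in> C" if "x \<in> standard_simplex 2" for x
  proof -
    have "x 0 + x 1 + x 2 = 1" "x 0 \<ge> 0" "x 1 \<ge> 0" "x 2 \<ge> 0"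
      using that by (auto simp: standard_simplex_def numeral_2_eq_2)
    then have "L x \<in> convex hull {a, b, c}"
      unfolding L_def convex_hull_3 by auto
    then show ?thesis
      using C abc hull_minimal[of "{a,b,c}" C convex] by auto
  qed
  have "continuous_on (standard_simplex 2) L"
    unfolding L_def
    by (intro continuous_intros continuous_on_subset[OF continuous_on_product_coordinates subset_UNIV])
  then have "continuous_on (standard_simplex 2) (\<lambda>x. g (L x))"
    by (rule continuous_on_compose2[OF g(1)]) (use L_mem in auto)
  then have \<sigma>: "singular_simplex 2 (top_of_set S) \<sigma>"
    unfolding \<sigma>_def by (rule singular_simplex_restrict) (use g(2) L_mem in auto)
  have mem: "simplical_face k x \<in> standard_simplex 2" if "x \<in> standard_simplex 1" "k \<le> 2" for k x
    using simplical_face_in_standard_simplex[of 2 k x] that by simp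
  have face: "singular_face 2 k \<sigma> = restrict (\<lambda>x. (g \<circ> linepath u v) (x 1)) (standard_simplex 1)"
    if "k \<le> 2" "\<And>x. x \<in> standard_simplex 1 \<Longrightarrow> L (simplical_face k x) = linepath u v (x 1)" for k u v
    using that mem by (auto simp: singular_face_def \<sigma>_def fun_eq_iff restrict_def)
  have "singular_face 2 0 \<sigma> = restrict (\<lambda>x. (g \<circ> linepath b c) (x 1)) (standard_simplex 1)"
    by (rule face) (auto simp: L_def simplical_face_def linepath_def standard_simplex_1_coord[simplified])
  moreover have "singular_face 2 1 \<sigma> = restrict (\<lambda>x. (g \<circ> linepath a c) (x 1)) (standard_simplex 1)"
    by (rule face) (auto simp: L_def simplical_face_def linepath_def standard_simplex_1_coord[simplified])
  moreover have "singular_face 2 2 \<sigma> = restrict (\<lambda>x. (g \<circ> linepath a b) (x 1)) (standard_simplex 1)"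
    by (rule face) (auto simp: L_def simplical_face_def linepath_def standard_simplex_1_coord[simplified])
  ultimately have "chain_boundary 2 (frag_of \<sigma>) =
      path_chain (g \<circ> linepath a b) + path_chain (g \<circ> linepath b c) - path_chain (g \<circ> linepath a c)"
    by (simp add: chain_boundary_def path_chain_def numeral_2_eq_2 atMost_Suc)
  moreover have "singular_chain 2 (top_of_set S) (frag_of \<sigma>)"
    using \<sigma> by (simp add: singular_chain_of)
  ultimately show ?thesis
    unfolding homologous_rel_def singular_boundary by (metis Suc_1)
qed

lemma path_chain_constant:
  assumes "a \<in> S"
  shows "homologous_in S (path_chain (\<lambda>_. a)) 0"
proof -
  \<comment> \<open>Three constant edges: \<open>x + x\<close> is homologous to \<open>x\<close>.\<close>
  have "homologous_in S (path_chain ((\<lambda>_::real. a) \<circ> linepath 0 0) + path_chain ((\<lambda>_::real. a) \<circ> linepath 0 0))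
           (path_chain ((\<lambda>_::real. a) \<circ> linepath 0 0))"
    by (rule path_chain_triangle[where C = UNIV]) (use assms in auto)
  then show ?thesis
    by (simp add: homologous_rel_def comp_def)
qed

lemma subpath_as_linepath: "subpath s t p = p \<circ> linepath s t"
  by (auto simp: subpath_def linepath_def algebra_simps fun_eq_iff)

lemma path_chain_subpath_add:
  fixes p :: "real \<Rightarrow> 'a::real_normed_vector"
  assumes "convex I" "continuous_on I p" "p ` I \<subseteq> S" "s \<in> I" "t \<in> I" "u \<in> I"
  shows "homologous_in S (path_chain (subpath s t p) + path_chain (subpath t u p)) (path_chain (subpath s u p))"
  unfolding subpath_as_linepath by (rule path_chain_triangle) (use assms in auto)

lemma path_chain_cong:
  assumes "\<And>x. x \<in> {0..1} \<Longrightarrow> p x = q x"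
  shows "path_chain p = path_chain q"
proof -
  have "restrict (\<lambda>x. p (x 1)) (standard_simplex 1) = restrict (\<lambda>x. q (x 1)) (standard_simplex 1)"
    by (rule restrict_ext) (use assms standard_simplex_1_range in auto)
  then show ?thesis by (simp add: path_chain_def)
qed

lemma path_chain_join:
  fixes p q :: "real \<Rightarrow> 'a::real_normed_vector"
  assumes "path p" "path q" "pathfinish p = pathstart q" "path_image p \<subseteq> S" "path_image q \<subseteq> S"
  shows "homologous_in S (path_chain p + path_chain q) (path_chain (p +++ q))"
proof -
  have "path (p +++ q)" "path_image (p +++ q) \<subseteq> S"
    using assms by (auto simp: path_image_join)
  then have "homologous_in S (path_chain (subpath 0 (1/2) (p +++ q)) + path_chain (subpath (1/2) 1 (p +++ q)))
      (path_chain (subpath 0 1 (p +++ q)))"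
    by (intro path_chain_subpath_add[where I = "{0..1}"]) (auto simp: path_def path_image_def)
  moreover have "path_chain (subpath 0 (1/2) (p +++ q)) = path_chain p"
    by (rule path_chain_cong) (auto simp: subpath_def joinpaths_def)
  moreover have "path_chain (subpath (1/2) 1 (p +++ q)) = path_chain q"
    by (rule path_chain_cong)
       (use assms(3) in \<open>auto simp: subpath_def joinpaths_def pathstart_def pathfinish_def field_simps\<close>)
  ultimately show ?thesis by (simp add: subpath_trivial)
qed

text \<open>
  The straight-line homotopy in \<open>C\<close> is a map of a square; each of the two triangles into which the
  diagonal cuts the square compares one of the two paths with the diagonal, because the other two
  sides of the square are constant.
\<close>

lemma path_chain_straighten:
  fixes g :: "'b::real_normed_vector \<Rightarrow> 'a::real_normed_vector"
  assumes C: "convex C" and g: "continuous_on C g" "g ` C \<subseteq> S"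
    and p: "path p" "path_image p \<subseteq> C"
  shows "homologous_in S (path_chain (g \<circ> p)) (path_chain (g \<circ> linepath (pathstart p) (pathfinish p)))"
proof -
  define l where "l = linepath (pathstart p) (pathfinish p)"
  \<comment> \<open>The horizontal coordinate is the homotopy parameter: the left side is \<open>g \<circ> p\<close>, the right side the image of the segment.\<close>
  define h where "h = (\<lambda>z::real \<times> real. (1 - fst z) *\<^sub>R p (snd z) + fst z *\<^sub>R l (snd z))"
  have l_mem: "l x \<in> C" if "x \<in> {0..1}" for x
  proof -
    have "pathstart p \<in> C" "pathfinish p \<in> C" using p(2) by auto
    then show ?thesis using C that closed_segment_subset[of _ C] linepath_in_path[of x] unfolding l_def by blast
  qed
  have p_mem: "p x \<in> C" if "x \<in> {0..1}" for x
    using p(2) that by (auto simp: path_image_def)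
  let ?Q = "{0..1} \<times> {0..1} :: (real \<times> real) set"
  have h_mem: "h ` ?Q \<subseteq> C"
  proof
    fix y assume "y \<in> h ` ?Q"
    then obtain z where z: "z \<in> ?Q" "y = h z" by auto
    show "y \<in> C"
      unfolding z(2) h_def by (rule convexD[OF C]) (use z(1) l_mem p_mem in auto)
  qed
  have "continuous_on ?Q (\<lambda>z. p (snd z))"
    by (rule continuous_on_compose2[OF p(1)[unfolded path_def]]) (auto intro: continuous_intros)
  moreover have "continuous_on ?Q (\<lambda>z. l (snd z))"
    unfolding l_def linepath_def by (intro continuous_intros)
  ultimately have "continuous_on ?Q h"
    unfolding h_def by (intro continuous_intros)
  then have gh: "continuous_on ?Q (g \<circ> h)"
    by (intro continuous_on_compose continuous_on_subset[OF g(1)] h_mem)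
  have ghS: "(g \<circ> h) ` ?Q \<subseteq> S" using h_mem g(2) by auto
  have cvx: "convex ?Q" by (intro convex_Times) auto
  note tri = path_chain_triangle[OF cvx gh ghS]
  let ?e = "\<lambda>a b. path_chain ((g \<circ> h) \<circ> linepath a b)"
  have const: "homologous_in S (?e (0,e) (1,e)) 0" if "e = 0 \<or> e = 1" for e
  proof -
    have "(g \<circ> h) \<circ> linepath (0,e) (1,e) = (\<lambda>_. g (p e))"
      using that by (auto simp: fun_eq_iff h_def l_def linepath_def pathstart_def pathfinish_def algebra_simps)
    moreover have "g (p e) \<in> S" using p_mem[of e] that g(2) by auto
    ultimately show ?thesis by (simp only: path_chain_constant)
  qed
  have "homologous_in S (?e (0,0) (0,1) + ?e (0,1) (1,1)) (?e (0,0) (1,1))"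
    by (rule tri) auto
  from homologous_rel_diff[OF this const[of 1]]
  have bottom: "homologous_in S (?e (0,0) (0,1)) (?e (0,0) (1,1))" by simp
  have "homologous_in S (?e (0,0) (1,0) + ?e (1,0) (1,1)) (?e (0,0) (1,1))"
    by (rule tri) auto
  from homologous_rel_diff[OF this const[of 0]]
  have top: "homologous_in S (?e (1,0) (1,1)) (?e (0,0) (1,1))" by simp
  have "homologous_in S (?e (0,0) (0,1)) (?e (1,0) (1,1))"
    using homologous_rel_trans[OF top[unfolded homologous_rel_sym[of _ _ _ "?e (1,0) (1,1)"]] bottom] .
  moreover have "?e (0,0) (0,1) = path_chain (g \<circ> p)" "?e (1,0) (1,1) = path_chain (g \<circ> l)"
    by (rule path_chain_cong, simp add: h_def linepath_def)+
  ultimately show ?thesis by (simp add: l_def)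
qed

lemma loop_class_path_chain:
  "loop_class S p = homologous_rel_set 1 (top_of_set S) {} (path_chain p)"
  by (simp add: loop_class_def path_chain_def)

lemma loop_class_eq_iff: "loop_class S p = loop_class S q \<longleftrightarrow> homologous_in S (path_chain p) (path_chain q)"
  by (simp add: loop_class_path_chain homologous_rel_set_eq)

lemma loop_class_in_carrier:
  assumes "loop_in S p"
  shows "loop_class S p \<in> carrier (homology_group 1 (top_of_set S))"
  using singular_cycle_loop[of p S] assms carrier_relative_homology_group[of 1 "top_of_set S" "{}"]
  by (auto simp: loop_class_path_chain)

lemma loop_class_add:
  assumes "homologous_in S (path_chain p + path_chain q) (path_chain r)"
  shows "loop_class S p \<otimes>\<^bsub>homology_group 1 (top_of_set S)\<^esub> loop_class S q = loop_class S r"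
proof -
  have "(\<Union>a\<in>homologous_rel_set 1 (top_of_set S) {} (path_chain p).
         \<Union>b\<in>homologous_rel_set 1 (top_of_set S) {} (path_chain q). {a + b})
        = homologous_rel_set 1 (top_of_set S) {} (path_chain p + path_chain q)" (is "?A = ?B")
  proof
    show "?A \<subseteq> ?B" by (auto intro: homologous_rel_add)
    show "?B \<subseteq> ?A"
    proof
      fix c assume c: "c \<in> ?B"
      then have "homologous_in S (path_chain q) (c - path_chain p)"
        by (simp add: homologous_rel_def algebra_simps)
      then show "c \<in> ?A" by force
    qed
  qed
  also have "\<dots> = loop_class S r"
    using assms by (simp add: loop_class_path_chain homologous_rel_set_eq)
  finally show ?thesis
    using mult_relative_homology_group[of 1 "top_of_set S" "{}"] by (simp add: loop_class_path_chain)
qed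

section \<open>Charts of a level surface\<close>

text \<open>
  A chart in the form needed below.  The map \<open>F y = y + (f y - n \<bullet> (y - c)) n\<close> moves points only along
  the normal \<open>n\<close> at \<open>c\<close> and makes \<open>f\<close> the height over the tangent plane, so it sends the level set into
  that plane.  Its derivative at \<open>y\<close> is inverted by an explicit formula wherever \<open>n \<bullet> g y > 0\<close>; local
  injectivity and invariance of domain then give the inverse \<open>G\<close>, and the formula shows that \<open>G\<close> is
  continuously differentiable.
\<close>

lemma level_set_chart:
  fixes f :: "'a::euclidean_space \<Rightarrow> real" and g :: "'a \<Rightarrow> 'a"
  assumes V: "open V" "c \<in> V" and g: "continuous_on V g" "\<And>y. y \<in> V \<Longrightarrow> GDERIV f y :> g y"
    and c: "g c \<noteq> 0" "f c = 0"
  obtains n F G G' U r where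
    "n = g c /\<^sub>R norm (g c)" "open U" "c \<in> U" "U \<subseteq> V" "continuous_on U F" "F c = c" "0 < r"
    "\<And>y. y \<in> U \<Longrightarrow> G (F y) = y"
    "\<And>y. \<exists>h. F y = y + h *\<^sub>R n"
    "\<And>y. n \<bullet> (F y - c) = f y"
    "\<And>z. z \<in> ball c r \<Longrightarrow> G z \<in> U \<and> F (G z) = z \<and> (G has_derivative G' z) (at z)"
    "\<And>v. continuous_on (ball c r) (\<lambda>z. G' z v)"
proof -
  define n where "n = g c /\<^sub>R norm (g c)"
  have n: "n \<bullet> n = 1"
    using c(1) by (simp add: n_def dot_square_norm power2_eq_square field_simps)
  have nc: "n \<bullet> g c > 0"
    using c(1) by (simp add: n_def dot_square_norm power2_eq_square)
  define F where "F = (\<lambda>y. y + (f y - n \<bullet> (y - c)) *\<^sub>R n)"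
  define F' where "F' = (\<lambda>y v. v + (v \<bullet> g y - n \<bullet> v) *\<^sub>R n)"
  define I where "I = (\<lambda>y w. w + ((n \<bullet> w - w \<bullet> g y) / (n \<bullet> g y)) *\<^sub>R n)"
  define V' where "V' = {y \<in> V. n \<bullet> g y > 0}"
  have "open V'"
  proof -
    have "continuous_on V (\<lambda>y. n \<bullet> g y)" by (intro continuous_intros g)
    then have "open ((\<lambda>y. n \<bullet> g y) -` {0<..} \<inter> V)"
      using V(1) by (metis continuous_on_open_vimage open_greaterThan)
    moreover have "(\<lambda>y. n \<bullet> g y) -` {0<..} \<inter> V = V'" by (auto simp: V'_def)
    ultimately show ?thesis by simp
  qed
  have cV': "c \<in> V'" using V nc by (simp add: V'_def)
  have derF: "(F has_derivative F' y) (at y)" if "y \<in> V'" for y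
  proof -
    have "(f has_derivative (\<lambda>h. h \<bullet> g y)) (at y)"
      using g(2)[of y] that by (simp add: V'_def gderiv_def)
    then show ?thesis
      unfolding F_def F'_def by (auto intro!: derivative_eq_intros)
  qed
  have FI: "F' y (I y w) = w" and IF: "I y (F' y w) = w" if "y \<in> V'" for y w
  proof -
    have "n \<bullet> g y \<noteq> 0" using that by (simp add: V'_def)
    then show "F' y (I y w) = w" "I y (F' y w) = w"
      unfolding F'_def I_def using n
      by (simp_all add: algebra_simps inner_add_left inner_add_right flip: scaleR_add_left scaleR_diff_left)
         (simp_all add: field_simps)
  qed
  have contF: "continuous_on V' F"
    using derF by (meson differentiable_at_imp_differentiable_on differentiable_def differentiable_imp_continuous_on)
  have blI: "bounded_linear (I c)"
    unfolding I_def divide_inverse by (intro bounded_linear_intros)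
  obtain \<rho> where \<rho>: "\<rho> > 0" "ball c \<rho> \<subseteq> V'" "inj_on F (ball c \<rho>)"
  proof (rule has_derivative_locally_injective[of c V' "I c" F' F])
    show "\<exists>d>0. \<forall>x. dist c x < d \<longrightarrow> onorm (\<lambda>v. F' x v - F' c v) < e" if "e > 0" for e
    proof -
      have "continuous (at c) g" using g(1) V continuous_on_eq_continuous_at by blast
      then obtain d where d: "d > 0" "\<And>x. dist x c < d \<Longrightarrow> dist (g x) (g c) < e/2"
        using \<open>e > 0\<close> unfolding continuous_at_eps_delta dist_norm[symmetric] by (meson half_gt_zero)
      have "onorm (\<lambda>v. F' x v - F' c v) < e" if "dist c x < d" for x
      proof -
        have nn: "norm n = 1" using n by (simp add: norm_eq_1)
        have "norm (F' x v - F' c v) \<le> e/2 * norm v" for v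
        proof -
          have "F' x v - F' c v = (v \<bullet> (g x - g c)) *\<^sub>R n"
            by (simp add: F'_def algebra_simps flip: scaleR_diff_left)
          then have "norm (F' x v - F' c v) \<le> norm v * norm (g x - g c)"
            using nn by (simp add: Cauchy_Schwarz_ineq2)
          also have "\<dots> \<le> norm v * (e/2)"
            using d(2)[of x] that by (intro mult_left_mono) (auto simp: dist_norm dist_commute norm_minus_commute)
          finally show ?thesis by (simp add: mult.commute)
        qed
        then have "onorm (\<lambda>v. F' x v - F' c v) \<le> e/2" by (rule onorm_bound[rotated]) (use \<open>e > 0\<close> in auto)
        then show ?thesis using \<open>e > 0\<close> by simp
      qed
      then show ?thesis using d(1) by blast
    qed
  qed (use \<open>open V'\<close> cV' blI derF IF in \<open>auto simp: fun_eq_iff\<close>)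
  define U where "U = ball c \<rho>"
  define G where "G = inv_into U F"
  have U: "open U" "c \<in> U" "U \<subseteq> V'" "inj_on F U" using \<rho> by (auto simp: U_def)
  have contFU: "continuous_on U F" using contF U(3) continuous_on_subset by blast
  have GF: "G (F y) = y" if "y \<in> U" for y using that U(4) by (simp add: G_def)
  have Fc: "F c = c" using c by (simp add: F_def)
  have "open (F ` U)" by (rule Further_Topology.invariance_of_domain[OF contFU U(1,4)])
  moreover have "c \<in> F ` U" using Fc U(2) by force
  ultimately obtain r where r: "r > 0" "ball c r \<subseteq> F ` U" using openE by blast
  have derG: "(G has_derivative I (G z)) (at z)" "G z \<in> U" "F (G z) = z" if "z \<in> F ` U" for z
  proof -
    from that obtain y where y: "y \<in> U" "z = F y" by auto
    have "(G has_derivative I y) (at (F y))"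
      by (rule has_derivative_inverse_strong[OF U(1) y(1) contFU GF derF])
         (use y U(3) FI in \<open>auto simp: fun_eq_iff\<close>)
    then show "(G has_derivative I (G z)) (at z)" "G z \<in> U" "F (G z) = z" using y GF by auto
  qed
  have contG: "continuous_on (ball c r) G"
    using derG(1) r(2)
    by (meson differentiable_at_imp_differentiable_on differentiable_def differentiable_imp_continuous_on subsetD)
  have GV: "G z \<in> V" if "z \<in> ball c r" for z
    using derG(2)[OF subsetD[OF r(2) that]] U(3) by (auto simp: V'_def)
  have gG: "continuous_on (ball c r) (\<lambda>z. g (G z))"
    by (rule continuous_on_compose2[OF g(1) contG]) (use GV in auto)
  have "\<And>z. z \<in> ball c r \<Longrightarrow> n \<bullet> g (G z) \<noteq> 0"
    using derG(2) r(2) U(3) by (fastforce simp: V'_def)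
  then have contG': "continuous_on (ball c r) (\<lambda>z. I (G z) v)" for v
    unfolding I_def by (intro continuous_intros gG) auto
  show ?thesis
  proof (rule that[of n U F r G "\<lambda>z. I (G z)"])
    show "\<exists>h. F y = y + h *\<^sub>R n" for y by (auto simp: F_def)
    show "n \<bullet> (F y - c) = f y" for y using n by (simp add: F_def algebra_simps)
    show "G z \<in> U \<and> F (G z) = z \<and> (G has_derivative I (G z)) (at z)" if "z \<in> ball c r" for z
      using derG[OF subsetD[OF r(2) that]] by blast
  qed (use n_def U contFU Fc r GF contG' in \<open>auto simp: V'_def\<close>)
qed

section \<open>Cutting a corner\<close>

text \<open>
  The difference of the unit vectors separates them because the Cauchy-Schwarz inequality is strict for
  independent vectors.
\<close>

lemma separating_direction:
  fixes a b :: "'a::real_inner"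
  assumes "\<And>x y. x *\<^sub>R a + y *\<^sub>R b = 0 \<Longrightarrow> x = 0 \<and> y = 0"
  defines "w \<equiv> a /\<^sub>R norm a - b /\<^sub>R norm b"
  shows "w \<bullet> a > 0" "w \<bullet> b < 0"
proof -
  have nz: "a \<noteq> 0" "b \<noteq> 0" using assms(1)[of 1 0] assms(1)[of 0 1] by auto
  have "a \<bullet> b \<noteq> norm a * norm b"
  proof
    assume "a \<bullet> b = norm a * norm b"
    then have "norm b *\<^sub>R a + (- norm a) *\<^sub>R b = 0"
      by (simp add: norm_cauchy_schwarz_eq)
    then show False using assms(1) nz by fastforce
  qed
  then have cs: "a \<bullet> b < norm a * norm b"
    using norm_cauchy_schwarz[of a b] by linarith
  have "w \<bullet> a = norm a - (a \<bullet> b) / norm b" "w \<bullet> b = (a \<bullet> b) / norm a - norm b"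
    using nz by (simp_all add: w_def inner_diff_left inner_commute[of b a] dot_square_norm power2_eq_square divide_inverse mult.commute)
  moreover have "(a \<bullet> b) / norm b < norm a" "(a \<bullet> b) / norm a < norm b"
    using cs nz by (simp_all add: divide_less_eq mult.commute)
  ultimately show "w \<bullet> a > 0" "w \<bullet> b < 0" by simp_all
qed

lemma surface_local_equation:
  assumes "closed_oriented_surface S N" "c \<in> S"
  shows "\<exists>V (f :: real^3 \<Rightarrow> real) g. open V \<and> c \<in> V \<and> continuous_on V g \<and>
     (\<forall>y\<in>V. GDERIV f y :> g y) \<and> g c \<noteq> 0 \<and> S \<inter> V = {y \<in> V. f y = 0}"
proof -
  have "\<exists>V (f :: real^3 \<Rightarrow> real) g. open V \<and> c \<in> V \<and> continuous_on V g \<and>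
     (\<forall>y\<in>V. GDERIV f y :> g y \<and> g y \<noteq> 0) \<and> S \<inter> V = {y \<in> V. f y = 0} \<and>
     (\<forall>y\<in>S \<inter> V. N y = g y /\<^sub>R norm (g y))"
    using assms unfolding closed_oriented_surface_def by (elim conjE) (rule bspec)
  then show ?thesis by fast
qed

lemma level_set_tangent:
  fixes \<gamma> :: "real \<Rightarrow> 'a::real_inner"
  assumes "open V" "\<gamma> s \<in> V" and f: "GDERIV f (\<gamma> s) :> v" and zero: "\<And>x. \<gamma> x \<in> V \<Longrightarrow> f (\<gamma> x) = 0"
    and \<gamma>: "continuous_on UNIV \<gamma>" "(\<gamma> has_vector_derivative a) (at s)"
  shows "v \<bullet> a = 0"
proof -
  have "((\<lambda>x. f (\<gamma> x)) has_derivative (\<lambda>h. (h *\<^sub>R a) \<bullet> v)) (at s)"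
    using has_derivative_compose[OF \<gamma>(2)[unfolded has_vector_derivative_def] f[unfolded gderiv_def]] .
  then have "((\<lambda>x. f (\<gamma> x)) has_real_derivative a \<bullet> v) (at s)"
    by (simp add: has_field_derivative_def mult.commute[of _ "a \<bullet> v"] mult_commute_abs)
  moreover have "((\<lambda>x. f (\<gamma> x)) has_real_derivative 0) (at s)"
  proof (rule DERIV_cong_ev[THEN iffD2])
    have "open (\<gamma> -` V)" using \<gamma>(1) assms(1) by (simp add: open_vimage)
    then show "\<forall>\<^sub>F x in nhds s. f (\<gamma> x) = 0"
      using assms(2) zero by (auto simp: eventually_nhds)
    show "((\<lambda>_. 0) has_real_derivative 0) (at s)" by simp
  qed auto
  ultimately show ?thesis by (metis DERIV_unique inner_commute)
qed

text \<open>
  The curve \<open>\<gamma>\<close> arrives at the double point at time \<open>t\<close> and leaves it at time \<open>s\<close>; the detour \<open>q\<close>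
  replaces the last piece before \<open>t\<close> followed by the first piece after \<open>s\<close>.  It is the image in the
  surface of a segment in the tangent plane.  Near the double point the linear functional \<open>w\<close> is larger
  than its value at the double point on these two pieces, hence on \<open>q\<close>, and smaller on the two
  remaining branches of \<open>\<gamma>\<close>; the rest of \<open>\<gamma>\<close> stays at a distance \<open>\<rho>\<close> from the double point.
\<close>

lemma corner_shortcut:
  fixes \<gamma> :: "real \<Rightarrow> real^3"
  assumes surf: "closed_oriented_surface S N" and \<gamma>S: "range \<gamma> \<subseteq> S"
    and per: "\<And>x. \<gamma> (x + 1) = \<gamma> x" and cont: "continuous_on UNIV \<gamma>"
    and st: "\<gamma> s = \<gamma> t"
    and a: "(\<gamma> has_vector_derivative a) (at s)" and b: "(\<gamma> has_vector_derivative b) (at t)"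
    and indep: "\<And>x y. x *\<^sub>R a + y *\<^sub>R b = 0 \<Longrightarrow> x = 0 \<and> y = 0"
    and no_return: "\<And>v. v \<in> {t<..<1+s} \<Longrightarrow> \<gamma> v \<noteq> \<gamma> s"
    and "\<delta>\<^sub>0 > 0"
  obtains \<delta> q where "0 < \<delta>" "\<delta> < \<delta>\<^sub>0" "q C1_differentiable_on {0..1}" "path_image q \<subseteq> S"
    "pathstart q = \<gamma> (t - \<delta>)" "pathfinish q = \<gamma> (s + \<delta>)"
    "\<And>x v. x \<in> {0..1} \<Longrightarrow> v \<in> {t..1+s} \<Longrightarrow> q x \<noteq> \<gamma> v"
    "homologous_in S (path_chain (subpath (t - \<delta>) t \<gamma>) + path_chain (subpath s (s + \<delta>) \<gamma>)) (path_chain q)"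
proof -
  define c where "c = \<gamma> s"
  have c: "\<gamma> s = c" "\<gamma> t = c" "c \<in> S" using st \<gamma>S by (auto simp: c_def)
  define w where "w = a /\<^sub>R norm a - b /\<^sub>R norm b"
  have wa: "w \<bullet> a > 0" and wb: "w \<bullet> b < 0"
    using separating_direction[OF indep] unfolding w_def by auto
  have "((\<lambda>x. w \<bullet> \<gamma> x) has_real_derivative w \<bullet> a) (at s)" "((\<lambda>x. w \<bullet> \<gamma> x) has_real_derivative w \<bullet> b) (at t)"
    using a b unfolding has_real_derivative_iff_has_vector_derivative
    by (auto intro!: bounded_linear.has_vector_derivative[OF bounded_linear_inner_right])
  note ders = this
  obtain d1 where d1: "d1 > 0" "\<And>h. 0 < h \<Longrightarrow> h < d1 \<Longrightarrow> w \<bullet> c < w \<bullet> \<gamma> (s + h)"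
    using DERIV_pos_inc_right[OF ders(1) wa] c by auto
  obtain d2 where d2: "d2 > 0" "\<And>h. 0 < h \<Longrightarrow> h < d2 \<Longrightarrow> w \<bullet> \<gamma> (s - h) < w \<bullet> c"
    using DERIV_pos_inc_left[OF ders(1) wa] c by auto
  obtain d3 where d3: "d3 > 0" "\<And>h. 0 < h \<Longrightarrow> h < d3 \<Longrightarrow> w \<bullet> \<gamma> (t + h) < w \<bullet> c"
    using DERIV_neg_dec_right[OF ders(2) wb] c by auto
  obtain d4 where d4: "d4 > 0" "\<And>h. 0 < h \<Longrightarrow> h < d4 \<Longrightarrow> w \<bullet> c < w \<bullet> \<gamma> (t - h)"
    using DERIV_neg_dec_left[OF ders(2) wb] c by auto
  define m where "m = min d2 d3 / 2"
  have m: "m > 0" "m < d2" "m < d3" using d2(1) d3(1) by (auto simp: m_def min_def)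
  obtain \<rho> where \<rho>: "\<rho> > 0" "\<And>v. v \<in> {t+m..1+s-m} \<Longrightarrow> \<gamma> v \<notin> ball c \<rho>"
  proof -
    have "compact (\<gamma> ` {t+m..1+s-m})"
      by (rule compact_continuous_image[OF continuous_on_subset[OF cont]]) auto
    then have "open (- (\<gamma> ` {t+m..1+s-m}))" by (simp add: compact_imp_closed open_Compl)
    moreover have "c \<in> - (\<gamma> ` {t+m..1+s-m})" using no_return c m by force
    ultimately obtain \<rho> where "\<rho> > 0" "ball c \<rho> \<subseteq> - (\<gamma> ` {t+m..1+s-m})" using openE by blast
    then show ?thesis using that by blast
  qed
  obtain V and f :: "real^3 \<Rightarrow> real" and g where V: "open V" "c \<in> V" "continuous_on V g"
    and f: "\<And>y. y \<in> V \<Longrightarrow> GDERIV f y :> g y" "g c \<noteq> 0" and SV: "S \<inter> V = {y \<in> V. f y = 0}"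
    using surface_local_equation[OF surf c(3)] by (elim exE conjE) (rule that, auto)
  have fc: "f c = 0" using SV V c by auto
  obtain n F G G' U r where chart:
    "n = g c /\<^sub>R norm (g c)" "open U" "c \<in> U" "U \<subseteq> V" "continuous_on U F" "F c = c" "0 < r"
    and GF: "\<And>y. y \<in> U \<Longrightarrow> G (F y) = y"
    and Fn: "\<And>y. \<exists>h. F y = y + h *\<^sub>R n"
    and nF: "\<And>y. n \<bullet> (F y - c) = f y"
    and G: "\<And>z. z \<in> ball c r \<Longrightarrow> G z \<in> U \<and> F (G z) = z \<and> (G has_derivative G' z) (at z)"
    and G': "\<And>v. continuous_on (ball c r) (\<lambda>z. G' z v)"
    by (rule level_set_chart[OF V f(1) f(2) fc]) blast+
  have zero: "f (\<gamma> x) = 0" if "\<gamma> x \<in> V" for x using SV that \<gamma>S by auto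
  have na: "n \<bullet> a = 0"
    using level_set_tangent[of V \<gamma> s f "g c" a] V zero cont a c f(1)[OF V(2)] by (simp add: chart(1))
  have nb: "n \<bullet> b = 0"
    using level_set_tangent[of V \<gamma> t f "g c" b] V zero cont b c f(1)[OF V(2)] by (simp add: chart(1))
  have wn: "w \<bullet> n = 0" using na nb by (simp add: w_def inner_diff_right inner_commute)
  \<comment> \<open>As \<open>w\<close> is tangent at \<open>c\<close>, the chart does not change \<open>w\<close>; this transfers convexity to the surface.\<close>
  have wF: "w \<bullet> F y = w \<bullet> y" for y using Fn[of y] wn by (auto simp: inner_add_right)
  have Gc: "G c = c" using GF[of c] chart by simp
  obtain r' where r': "r' > 0" "r' \<le> r" "\<And>z. z \<in> ball c r' \<Longrightarrow> G z \<in> ball c \<rho>"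
  proof -
    have "isCont G c" using G[of c] chart(7) has_derivative_continuous by force
    then obtain e where "e > 0" "\<And>z. dist z c < e \<Longrightarrow> dist (G z) c < \<rho>"
      using \<rho>(1) Gc unfolding continuous_at_eps_delta dist_norm[symmetric] by metis
    then show ?thesis using that[of "min e r"] chart(7) by (auto simp: dist_commute)
  qed
  \<comment> \<open>The part of the tangent plane over which the detour is built.\<close>
  define C where "C = ball c r' \<inter> {z. n \<bullet> z = n \<bullet> c}"
  have near: "\<exists>e>0. \<forall>x. \<bar>x - u\<bar> < e \<longrightarrow> \<gamma> x \<in> U \<and> F (\<gamma> x) \<in> C" if "\<gamma> u = c" for u
  proof -
    have "open (U \<inter> F -` ball c r')"
      using continuous_open_preimage[OF chart(5,2) open_ball] by simp
    then have "open (\<gamma> -` (U \<inter> F -` ball c r'))" using cont open_vimage by blast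
    moreover have "u \<in> \<gamma> -` (U \<inter> F -` ball c r')" using that chart r' by simp
    ultimately obtain e where e: "e > 0" "ball u e \<subseteq> \<gamma> -` (U \<inter> F -` ball c r')" using openE by metis
    have "\<gamma> x \<in> U \<and> F (\<gamma> x) \<in> C" if "\<bar>x - u\<bar> < e" for x
    proof -
      have x: "\<gamma> x \<in> U" "F (\<gamma> x) \<in> ball c r'"
        using e(2) that by (auto simp: subset_iff dist_real_def abs_minus_commute)
      then have "n \<bullet> (F (\<gamma> x) - c) = 0" using nF zero chart(4) by auto
      then show ?thesis using x by (simp add: C_def inner_diff_right)
    qed
    then show ?thesis using e(1) by blast
  qed
  obtain e1 where e1: "e1 > 0" "\<And>x. \<bar>x - s\<bar> < e1 \<Longrightarrow> \<gamma> x \<in> U \<and> F (\<gamma> x) \<in> C" using near[OF c(1)] by auto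
  obtain e2 where e2: "e2 > 0" "\<And>x. \<bar>x - t\<bar> < e2 \<Longrightarrow> \<gamma> x \<in> U \<and> F (\<gamma> x) \<in> C" using near[OF c(2)] by auto
  \<comment> \<open>Half of the minimum makes all five bounds strict.\<close>
  define \<delta> where "\<delta> = Min {\<delta>\<^sub>0, d1, d4, e1, e2} / 2"
  have "Min {\<delta>\<^sub>0, d1, d4, e1, e2} > 0" using \<open>\<delta>\<^sub>0 > 0\<close> d1 d4 e1 e2 by simp
  moreover have "Min {\<delta>\<^sub>0, d1, d4, e1, e2} \<le> x" if "x \<in> {\<delta>\<^sub>0, d1, d4, e1, e2}" for x
    using that by (intro Min_le) auto
  ultimately have \<delta>: "\<delta> > 0" "\<delta> < \<delta>\<^sub>0" "\<delta> < d1" "\<delta> < d4" "\<delta> < e1" "\<delta> < e2"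
    unfolding \<delta>_def by fastforce+
  have C: "convex C" unfolding C_def by (intro convex_Int convex_ball convex_hyperplane)
  have Cr: "C \<subseteq> ball c r" using r' by (auto simp: C_def)
  have contG: "continuous_on C G"
    using G Cr by (meson differentiable_at_imp_differentiable_on differentiable_def differentiable_imp_continuous_on subsetD)
  have GS: "G ` C \<subseteq> S"
  proof
    fix y assume "y \<in> G ` C"
    then obtain z where z: "z \<in> C" "y = G z" by auto
    then have "y \<in> U" "F y = z" using G[of z] Cr by auto
    then have "f y = 0" using nF[of y] z by (simp add: C_def inner_diff_right)
    then show "y \<in> S" using SV \<open>y \<in> U\<close> chart(4) by auto
  qed
  define A where "A = F (\<gamma> (t - \<delta>))"
  define B where "B = F (\<gamma> (s + \<delta>))"
  have AB: "A \<in> C" "B \<in> C" unfolding A_def B_def using e1(2) e2(2) \<delta> by auto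
  have cC: "c \<in> C" using r' by (simp add: C_def)
  define q where "q = G \<circ> linepath A B"
  have l: "linepath A B x \<in> C" if "x \<in> {0..1}" for x
    using closed_segment_subset[OF AB C] that linepath_in_path[of x A B] by blast
  show ?thesis
  proof (rule that[of \<delta> q])
    show "q C1_differentiable_on {0..1}"
      unfolding C1_differentiable_on_def
    proof (intro exI[of _ "\<lambda>x. G' (linepath A B x) (B - A)"] conjI ballI)
      fix x :: real assume "x \<in> {0..1}"
      then have "(G has_derivative G' (linepath A B x)) (at (linepath A B x) within linepath A B ` UNIV)"
        using G[OF subsetD[OF Cr l]] has_derivative_at_withinI by blast
      then show "(q has_vector_derivative G' (linepath A B x) (B - A)) (at x)"
        unfolding q_def by (intro vector_derivative_diff_chain_within has_vector_derivative_linepath_within)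
    next
      show "continuous_on {0..1} (\<lambda>x. G' (linepath A B x) (B - A))"
        by (rule continuous_on_compose2[OF G']) (use l Cr in \<open>auto intro!: continuous_on_linepath\<close>)
    qed
    show "path_image q \<subseteq> S" unfolding path_image_def q_def using l GS by auto
    show q0: "pathstart q = \<gamma> (t - \<delta>)"
      using GF[of "\<gamma> (t - \<delta>)"] e2(2)[of "t - \<delta>"] \<delta> by (simp add: q_def A_def pathstart_def linepath_0')
    show q1: "pathfinish q = \<gamma> (s + \<delta>)"
      using GF[of "\<gamma> (s + \<delta>)"] e1(2)[of "s + \<delta>"] \<delta> by (simp add: q_def B_def pathfinish_def linepath_1')
    show "q x \<noteq> \<gamma> v" if x: "x \<in> {0..1}" and v: "v \<in> {t..1+s}" for x v
    proof -
      have "w \<bullet> A > w \<bullet> c" "w \<bullet> B > w \<bullet> c"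
        unfolding A_def B_def wF using d1(2) d4(2) \<delta> by auto
      then have "linepath A B x \<in> {z. w \<bullet> z > w \<bullet> c}"
        using closed_segment_subset[OF _ _ convex_halfspace_gt[where a = w and b = "w \<bullet> c"], of A B] linepath_in_path[OF x, of A B] by auto
      moreover have "w \<bullet> q x = w \<bullet> linepath A B x"
        using wF[of "q x"] G[OF subsetD[OF Cr l[OF x]]] by (simp add: q_def)
      ultimately have above: "w \<bullet> q x > w \<bullet> c" by simp
      have close: "q x \<in> ball c \<rho>" using r'(3) l[OF x] by (simp add: q_def C_def)
      consider "v = t" | "v = 1 + s" | "v \<in> {t<..<t+m}" | "v \<in> {1+s-m<..<1+s}" | "v \<in> {t+m..1+s-m}"
        using v by fastforce
      then show ?thesis
      proof cases
        case 1 then show ?thesis using above c by auto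
      next
        case 2 then show ?thesis using above c per[of s] by (auto simp: add.commute)
      next
        case 3 then have "w \<bullet> \<gamma> v < w \<bullet> c" using d3(2)[of "v - t"] m by auto
        then show ?thesis using above by auto
      next
        case 4 then have "w \<bullet> \<gamma> (v - 1) < w \<bullet> c" using d2(2)[of "1 + s - v"] m by (auto simp: algebra_simps)
        then show ?thesis using above per[of "v - 1"] by auto
      next
        case 5 then show ?thesis using \<rho>(2) close by auto
      qed
    qed
    have chart_of: "path_chain (G \<circ> (F \<circ> subpath u v \<gamma>)) = path_chain (subpath u v \<gamma>) \<and>
        path (F \<circ> subpath u v \<gamma>) \<and> path_image (F \<circ> subpath u v \<gamma>) \<subseteq> C"
      if uv: "u \<le> v" "\<And>x. x \<in> {u..v} \<Longrightarrow> \<gamma> x \<in> U \<and> F (\<gamma> x) \<in> C" for u v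
    proof -
      have img: "subpath u v \<gamma> x \<in> U \<and> F (subpath u v \<gamma> x) \<in> C" if "x \<in> {0..1}" for x
      proof -
        have "(v - u) * x + u \<in> {u..v}" 
          using that uv(1) mult_left_le[of x "v - u"] by auto
        then show ?thesis using uv(2) by (simp add: subpath_def)
      qed
      have "path (subpath u v \<gamma>)"
        unfolding path_def subpath_def by (intro continuous_on_compose2[OF cont] continuous_intros) auto
      then have "path (F \<circ> subpath u v \<gamma>)"
        unfolding path_def using img by (intro continuous_on_compose continuous_on_subset[OF chart(5)]) auto
      then show ?thesis using img GF by (auto simp: path_image_def intro: path_chain_cong)
    qed
    have in1: "\<gamma> x \<in> U \<and> F (\<gamma> x) \<in> C" if "x \<in> {t-\<delta>..t}" for x using e2(2)[of x] that \<delta> by auto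
    have in2: "\<gamma> x \<in> U \<and> F (\<gamma> x) \<in> C" if "x \<in> {s..s+\<delta>}" for x using e1(2)[of x] that \<delta> by auto
    have straight: "homologous_in S (path_chain (subpath u v \<gamma>)) (path_chain (G \<circ> linepath (F (\<gamma> u)) (F (\<gamma> v))))"
      if "u \<le> v" "\<And>x. x \<in> {u..v} \<Longrightarrow> \<gamma> x \<in> U \<and> F (\<gamma> x) \<in> C" for u v
    proof -
      have "pathstart (F \<circ> subpath u v \<gamma>) = F (\<gamma> u)" "pathfinish (F \<circ> subpath u v \<gamma>) = F (\<gamma> v)"
        by (simp_all add: pathstart_def pathfinish_def subpath_def)
      then show ?thesis
        using path_chain_straighten[OF C contG GS, of "F \<circ> subpath u v \<gamma>"] chart_of[OF that] by simp
    qed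
    have "homologous_in S (path_chain (subpath (t - \<delta>) t \<gamma>)) (path_chain (G \<circ> linepath A c))"
      using straight[of "t - \<delta>" t, OF _ in1] \<delta> c chart(6) by (simp add: A_def)
    moreover have "homologous_in S (path_chain (subpath s (s + \<delta>) \<gamma>)) (path_chain (G \<circ> linepath c B))"
      using straight[of s "s + \<delta>", OF _ in2] \<delta> c chart(6) by (simp add: B_def)
    ultimately have "homologous_in S (path_chain (subpath (t - \<delta>) t \<gamma>) + path_chain (subpath s (s + \<delta>) \<gamma>))
        (path_chain (G \<circ> linepath A c) + path_chain (G \<circ> linepath c B))"
      by (rule homologous_rel_add)
    then show "homologous_in S (path_chain (subpath (t - \<delta>) t \<gamma>) + path_chain (subpath s (s + \<delta>) \<gamma>)) (path_chain q)"
      unfolding q_def by (rule homologous_rel_trans[OF path_chain_triangle[OF C contG GS AB(1) cC AB(2)]])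
  qed (use \<delta> in auto)
qed

section \<open>The intersection number of the two smoothed loops\<close>

lemma subpath_has_vector_derivative:
  assumes "(\<gamma> has_vector_derivative d) (at ((v - u) * x + u))"
  shows "(subpath u v \<gamma> has_vector_derivative (v - u) *\<^sub>R d) (at x)"
proof -
  have "((\<lambda>x. (v - u) * x + u) has_vector_derivative (v - u)) (at x)"
    unfolding has_real_derivative_iff_has_vector_derivative[symmetric]
    by (auto intro!: derivative_eq_intros)
  from vector_diff_chain_at[OF this assms] show ?thesis
    by (simp add: subpath_def comp_def)
qed

lemma C1_differentiable_on_subpath:
  fixes \<gamma> :: "real \<Rightarrow> 'a::real_normed_vector"
  assumes "\<gamma> C1_differentiable_on UNIV"
  shows "subpath u v \<gamma> C1_differentiable_on A"
proof -
  obtain D where D: "\<And>x. (\<gamma> has_vector_derivative D x) (at x)" "continuous_on UNIV D"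
    using assms unfolding C1_differentiable_on_def by auto
  show ?thesis
    unfolding C1_differentiable_on_def
    by (intro exI[of _ "\<lambda>x. (v - u) *\<^sub>R D ((v - u) * x + u)"] conjI ballI
              subpath_has_vector_derivative D(1) continuous_intros continuous_on_compose2[OF D(2)]) auto
qed

lemma sgn_int_pos_mult: "c > 0 \<Longrightarrow> sgn_int (c * x) = sgn_int x"
  by (auto simp: sgn_int_def zero_less_mult_iff mult_less_0_iff)

lemma sgn_int_minus: "sgn_int (- x) = - sgn_int x"
  by (auto simp: sgn_int_def)

text \<open>
  Only the directions of the two velocities matter, so the sign is not affected by the
  reparametrisations involved in \<open>subpath\<close> and in the joining of paths.
\<close>

lemma local_intersection_sign_scaled:
  assumes "(p has_vector_derivative \<alpha> *\<^sub>R a) (at x)" "(q has_vector_derivative \<beta> *\<^sub>R b) (at y)"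
    and "\<alpha> > 0" "\<beta> > 0"
  shows "local_intersection_sign N p q x y = sgn_int (N (p x) \<bullet> cross3 a b)"
proof -
  have "local_intersection_sign N p q x y = sgn_int ((\<alpha> * \<beta>) * (N (p x) \<bullet> cross3 a b))"
    unfolding local_intersection_sign_def vector_derivative_at[OF assms(1)] vector_derivative_at[OF assms(2)]
    by (simp add: cross_mult_left cross_mult_right mult_ac)
  then show ?thesis using assms(3,4) by (simp add: sgn_int_pos_mult)
qed

lemma local_intersection_sign_swap:
  assumes "p s = p t"
  shows "local_intersection_sign N p p t s = - local_intersection_sign N p p s t"
  using assms cross_skew[of "vector_derivative p (at t)" "vector_derivative p (at s)"]
  by (simp add: local_intersection_sign_def sgn_int_minus)

text \<open>
  For a realization, nonvanishing of the signs is inherited from the planar diagram, whose crossings are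
  transversal.
\<close>

locale realized_knot =
  fixes R :: realization and \<iota> :: pairing
  assumes diagram: "surface_knot_diagram R"
    and form: "intersection_form (surface R) (unit_normal R) \<iota>"
    and sign_nonzero: "\<And>s t. (s, t) \<in> double_pairs {0..<1} (knot R) \<Longrightarrow>
                  local_intersection_sign (unit_normal R) (knot R) (knot R) s t \<noteq> 0"
begin

abbreviation "\<gamma> \<equiv> knot R"
abbreviation "S \<equiv> surface R"
abbreviation "N \<equiv> unit_normal R"
abbreviation "P \<equiv> double_pairs {0..<1} \<gamma>"
abbreviation sign :: "real \<times> real \<Rightarrow> int" where
  "sign z \<equiv> local_intersection_sign N \<gamma> \<gamma> (fst z) (snd z)"
abbreviation "velocity x \<equiv> vector_derivative \<gamma> (at x)"

lemma surface: "closed_oriented_surface S N" and range: "range \<gamma> \<subseteq> S" and periodic: "\<gamma> (x + 1) = \<gamma> x"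
  and C1: "\<gamma> C1_differentiable_on UNIV" and transversal: "transversal_double_points {0..<1} \<gamma>"
  using diagram by (auto simp: surface_knot_diagram_def immersed_def)

lemma finite_P: "finite P"
  using transversal by (simp add: transversal_double_points_def)

lemma velocity: "(\<gamma> has_vector_derivative velocity x) (at x)"
  using C1 by (auto simp: C1_differentiable_on_eq vector_derivative_works)

lemma continuous: "continuous_on UNIV \<gamma>"
  using C1 by (rule C1_differentiable_imp_continuous_on)

lemma velocity_periodic: "velocity (x + 1) = velocity x"
proof -
  have "((\<lambda>y. y + 1) has_vector_derivative 1) (at x)"
    unfolding has_real_derivative_iff_has_vector_derivative[symmetric] by (auto intro!: derivative_eq_intros)
  from vector_diff_chain_at[OF this velocity] have "(\<gamma> has_vector_derivative velocity (x + 1)) (at x)"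
    by (simp add: comp_def periodic)
  then show ?thesis by (simp add: vector_derivative_at)
qed

lemma P_iff: "(u, v) \<in> P \<longleftrightarrow> u \<in> {0..<1} \<and> v \<in> {0..<1} \<and> u \<noteq> v \<and> \<gamma> u = \<gamma> v"
  by (auto simp: double_pairs_def)

lemma P_unique: "(u, v) \<in> P \<Longrightarrow> (u, v') \<in> P \<Longrightarrow> v = v'"
  using transversal unfolding transversal_double_points_def by blast

lemma P_independent: "(u, v) \<in> P \<Longrightarrow> x *\<^sub>R velocity u + y *\<^sub>R velocity v = 0 \<Longrightarrow> x = 0 \<and> y = 0"
  using transversal unfolding transversal_double_points_def by blast

lemma subpath_loop:
  assumes "\<gamma> u = \<gamma> v"
  shows "valid_path (subpath u v \<gamma>)" "loop_in S (subpath u v \<gamma>)"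
proof -
  show "valid_path (subpath u v \<gamma>)"
    unfolding valid_path_def by (intro C1_differentiable_imp_piecewise C1_differentiable_on_subpath C1)
  moreover have "path_image (subpath u v \<gamma>) \<subseteq> S"
    using range by (auto simp: path_image_def subpath_def)
  ultimately show "loop_in S (subpath u v \<gamma>)"
    using assms by (simp add: valid_path_imp_path)
qed

lemma subpath_add:
  "homologous_in S (path_chain (subpath u v \<gamma>) + path_chain (subpath v w \<gamma>)) (path_chain (subpath u w \<gamma>))"
  by (rule path_chain_subpath_add[where I = UNIV]) (use continuous range in auto)

text \<open>
  By periodicity the initial piece up to \<open>u\<close> may be moved from the front of the period to its end.
\<close>

lemma subpath_rotate: "homologous_in S (path_chain (subpath u (1 + u) \<gamma>)) (path_chain (subpath 0 1 \<gamma>))"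
proof -
  have "subpath 1 (1 + u) \<gamma> = subpath 0 u \<gamma>"
    using periodic[of "u * _"] by (auto simp: subpath_def fun_eq_iff add.commute)
  then have "homologous_in S (path_chain (subpath 0 1 \<gamma>) + path_chain (subpath 0 u \<gamma>)) (path_chain (subpath 0 (1 + u) \<gamma>))"
    using subpath_add[of 0 1 "1 + u"] by simp
  from homologous_rel_diff[OF this homologous_rel_refl[of _ _ _ "path_chain (subpath 0 u \<gamma>)"]]
  have 1: "homologous_in S (path_chain (subpath 0 1 \<gamma>)) (path_chain (subpath 0 (1 + u) \<gamma>) - path_chain (subpath 0 u \<gamma>))"
    by simp
  from homologous_rel_diff[OF subpath_add[of 0 u "1+u"] homologous_rel_refl[of _ _ _ "path_chain (subpath 0 u \<gamma>)"]]
  have "homologous_in S (path_chain (subpath u (1 + u) \<gamma>)) (path_chain (subpath 0 (1 + u) \<gamma>) - path_chain (subpath 0 u \<gamma>))"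
    by simp
  with 1 show ?thesis using homologous_rel_sym homologous_rel_trans by blast
qed

lemma smoothing_sum:
  "homologous_in S (path_chain (subpath u v \<gamma>) + path_chain (subpath v (1 + u) \<gamma>)) (path_chain (subpath 0 1 \<gamma>))"
  using homologous_rel_trans[OF subpath_rotate subpath_add] .

lemma form_loop_add:
  assumes "loop_in S p" "loop_in S q" "loop_in S x"
    and "homologous_in S (path_chain p + path_chain q) (path_chain r)"
  shows "\<iota> (loop_class S r) (loop_class S x) = \<iota> (loop_class S p) (loop_class S x) + \<iota> (loop_class S q) (loop_class S x)"
proof -
  have "(\<lambda>z. \<iota> z (loop_class S x)) \<in> hom (homology_group 1 (top_of_set S)) integer_group"
    using form loop_class_in_carrier[OF assms(3)] by (simp add: intersection_form_def Let_def)
  from hom_mult[OF this loop_class_in_carrier[OF assms(1)] loop_class_in_carrier[OF assms(2)]]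
  show ?thesis by (simp add: loop_class_add[OF assms(4)])
qed

lemma form_loop_skew:
  assumes "loop_in S p" "loop_in S q"
  shows "\<iota> (loop_class S q) (loop_class S p) = - \<iota> (loop_class S p) (loop_class S q)"
proof -
  have "\<forall>x \<in> carrier (homology_group 1 (top_of_set S)). \<forall>y \<in> carrier (homology_group 1 (top_of_set S)).
          \<iota> y x = - \<iota> x y"
    using form unfolding intersection_form_def Let_def by blast
  then show ?thesis
    using loop_class_in_carrier[OF assms(1)] loop_class_in_carrier[OF assms(2)] by blast
qed

lemma form_transversal:
  assumes "valid_path p" "loop_in S p" "valid_path q" "loop_in S q" "meet_transversally N p q"
  shows "\<iota> (loop_class S p) (loop_class S q) =
           (\<Sum>(s, t) \<in> intersection_pairs p q. local_intersection_sign N p q s t)"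
  using form assms unfolding intersection_form_def Let_def by blast

text \<open>
  The double points passed once inside and once outside \<open>[s, t]\<close>, each listed once, with the inner
  passage first.
\<close>

definition "linked s t = {(u, v) \<in> P. u \<in> {s<..<t} \<and> v \<notin> {s..t}}"

text \<open>
  After the corner of the first loop has been cut by a detour \<open>q\<close> that avoids the second loop, the two
  loops meet exactly at the linked double points, and there they have the velocities of \<open>\<gamma>\<close> up to
  positive factors.
\<close>

lemma smoothing_intersection:
  assumes st: "(s, t) \<in> P" "s < t"
  shows "\<iota> (loop_class S (subpath s t \<gamma>)) (loop_class S (subpath t (1 + s) \<gamma>)) = sum sign (linked s t)"
proof -
  have st': "0 \<le> s" "t < 1" "\<gamma> s = \<gamma> t" using st by (auto simp: P_iff)
  have no_return: "\<gamma> v \<noteq> \<gamma> s" if "v \<in> {t<..<1+s}" for v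
  proof
    assume eq: "\<gamma> v = \<gamma> s"
    show False
    proof (cases "v < 1")
      case True
      then have "(s, v) \<in> P" using eq that st' st by (simp add: P_iff)
      then show False using P_unique[OF st(1)] that by auto
    next
      case False
      then have "(s, v - 1) \<in> P" using eq that st' st periodic[of "v - 1"] by (simp add: P_iff)
      then show False using P_unique[OF st(1), of "v - 1"] that st' st(2) by auto
    qed
  qed
  define A where "A = {u \<in> {s<..<t}. \<exists>v. (u, v) \<in> P}"
  have "finite A" by (rule finite_subset[OF _ finite_imageI[OF finite_P, of fst]]) (force simp: A_def)
  \<comment> \<open>All double points strictly between \<open>s\<close> and \<open>t\<close> keep a distance \<open>\<delta>\<^sub>0\<close> from the ends, so the detour loses none of them.\<close>
  define \<delta>\<^sub>0 where "\<delta>\<^sub>0 = Min (insert ((t - s)/2) ((\<lambda>u. min (u - s) (t - u)) ` A))"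
  have \<delta>\<^sub>0: "\<delta>\<^sub>0 > 0" unfolding \<delta>\<^sub>0_def using \<open>finite A\<close> st(2) by (auto simp: A_def)
  have \<delta>\<^sub>0_le: "\<delta>\<^sub>0 \<le> (t - s)/2" "\<And>u. u \<in> A \<Longrightarrow> s + \<delta>\<^sub>0 \<le> u \<and> u \<le> t - \<delta>\<^sub>0"
  proof -
    show "\<delta>\<^sub>0 \<le> (t - s)/2" unfolding \<delta>\<^sub>0_def using \<open>finite A\<close> by (intro Min_le) auto
    fix u assume "u \<in> A"
    then have "\<delta>\<^sub>0 \<le> min (u - s) (t - u)" unfolding \<delta>\<^sub>0_def using \<open>finite A\<close> by (intro Min_le) auto
    then show "s + \<delta>\<^sub>0 \<le> u \<and> u \<le> t - \<delta>\<^sub>0" by linarith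
  qed
  obtain \<delta> q where \<delta>: "0 < \<delta>" "\<delta> < \<delta>\<^sub>0"
    and q: "q C1_differentiable_on {0..1}" "path_image q \<subseteq> S"
      "pathstart q = \<gamma> (t - \<delta>)" "pathfinish q = \<gamma> (s + \<delta>)"
    and q_avoid: "\<And>x v. x \<in> {0..1} \<Longrightarrow> v \<in> {t..1+s} \<Longrightarrow> q x \<noteq> \<gamma> v"
    and q_hom: "homologous_in S (path_chain (subpath (t - \<delta>) t \<gamma>) + path_chain (subpath s (s + \<delta>) \<gamma>)) (path_chain q)"
    by (rule corner_shortcut[OF surface range periodic continuous st'(3) velocity velocity
          P_independent[OF st(1)] no_return \<delta>\<^sub>0]) blast+
  define m where "m = t - s - 2 * \<delta>"
  have m: "m > 0" using \<delta> \<delta>\<^sub>0_le(1) by (simp add: m_def)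
  define p\<^sub>1 where "p\<^sub>1 = subpath (s + \<delta>) (t - \<delta>) \<gamma>"
  define p where "p = p\<^sub>1 +++ q"
  define r where "r = subpath t (1 + s) \<gamma>"
  have p1: "p\<^sub>1 x = \<gamma> (m * x + (s + \<delta>))" for x by (simp add: p\<^sub>1_def subpath_def m_def algebra_simps)
  have r_eq: "r y = \<gamma> ((1 + s - t) * y + t)" for y by (simp add: r_def subpath_def)
  have vp1: "valid_path p\<^sub>1"
    unfolding p\<^sub>1_def valid_path_def by (intro C1_differentiable_imp_piecewise C1_differentiable_on_subpath C1)
  have vq: "valid_path q" using q(1) by (simp add: valid_path_def C1_differentiable_imp_piecewise)
  have ends: "pathfinish p\<^sub>1 = pathstart q" "pathfinish q = pathstart p\<^sub>1"
    using q by (simp_all add: p\<^sub>1_def)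
  have p1S: "path_image p\<^sub>1 \<subseteq> S" using range by (auto simp: path_image_def p1)
  have vp: "valid_path p" unfolding p_def using vp1 vq ends by (intro valid_path_join)
  have loop_p: "loop_in S p"
    using vp ends p1S q(2) by (simp add: p_def valid_path_imp_path path_image_join)
  have "\<gamma> t = \<gamma> (1 + s)" using st' periodic[of s] by (simp add: add.commute)
  note r_loop = subpath_loop[OF this, folded r_def]
  have class_p: "loop_class S p = loop_class S (subpath s t \<gamma>)"
    unfolding loop_class_eq_iff
  proof -
    let ?c = "\<lambda>u v. path_chain (subpath u v \<gamma>)"
    have "homologous_in S (path_chain p\<^sub>1 + path_chain q) (path_chain p)"
      unfolding p_def using vp1 vq ends p1S q(2) by (intro path_chain_join) (auto intro: valid_path_imp_path)
    moreover have "homologous_in S (path_chain p\<^sub>1 + (?c (t - \<delta>) t + ?c s (s + \<delta>))) (path_chain p\<^sub>1 + path_chain q)"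
      using q_hom by (intro homologous_rel_add) auto
    ultimately have 1: "homologous_in S (path_chain p\<^sub>1 + (?c (t - \<delta>) t + ?c s (s + \<delta>))) (path_chain p)"
      by (rule homologous_rel_trans)
    have "homologous_in S ((?c s (s + \<delta>) + path_chain p\<^sub>1) + ?c (t - \<delta>) t) (?c s (t - \<delta>) + ?c (t - \<delta>) t)"
      unfolding p\<^sub>1_def by (intro homologous_rel_add subpath_add homologous_rel_refl)
    then have "homologous_in S ((?c s (s + \<delta>) + path_chain p\<^sub>1) + ?c (t - \<delta>) t) (?c s t)"
      by (rule homologous_rel_trans[OF subpath_add])
    then have 2: "homologous_in S (path_chain p\<^sub>1 + (?c (t - \<delta>) t + ?c s (s + \<delta>))) (?c s t)"
      by (simp add: ac_simps)
    show "homologous_in S (path_chain p) (?c s t)"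
      using homologous_rel_trans[OF 2 iffD1[OF homologous_rel_sym 1]] .
  qed
  \<comment> \<open>The parameters at which the new loop and the second loop pass a linked double point.  The second loop runs over \<open>[t, 1 + s]\<close>, so times before \<open>s\<close> are shifted by one period.\<close>
  define \<psi> where "\<psi> = (\<lambda>(u, v). ((u - (s + \<delta>)) / m / 2, ((if v < s then v + 1 else v) - t) / (1 + s - t)))"
  have ts: "1 + s - t > 0" using st' by simp
  have point: "\<psi> (u, v) \<in> intersection_pairs p r \<and> fst (\<psi> (u, v)) \<in> {0<..<1/2} \<and> snd (\<psi> (u, v)) \<in> {0<..<1} \<and>
      (p has_vector_derivative (2 * m) *\<^sub>R velocity u) (at (fst (\<psi> (u, v)))) \<and>
      (r has_vector_derivative (1 + s - t) *\<^sub>R velocity v) (at (snd (\<psi> (u, v)))) \<and> p (fst (\<psi> (u, v))) = \<gamma> u"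
    if uv: "(u, v) \<in> linked s t" for u v
  proof -
    have P: "(u, v) \<in> P" "s < u" "u < t" "v < s \<or> t < v" using uv by (auto simp: linked_def)
    then have "u \<in> A" by (auto simp: A_def)
    then have u: "s + \<delta> < u" "u < t - \<delta>" using \<delta>\<^sub>0_le(2)[of u] \<delta> by auto
    have v: "0 \<le> v" "v < 1" and eq: "\<gamma> u = \<gamma> v" using P by (auto simp: P_iff)
    define x where "x = (u - (s + \<delta>)) / m / 2"
    define w where "w = (if v < s then v + 1 else v)"
    define y where "y = (w - t) / (1 + s - t)"
    have \<psi>: "\<psi> (u, v) = (x, y)" by (simp add: \<psi>_def x_def y_def w_def)
    have x: "0 < x" "x < 1/2" and mx: "m * (2 * x) + (s + \<delta>) = u"
      using u m by (simp_all add: x_def field_simps) (simp_all add: m_def)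
    have w: "t < w" "w < 1 + s" using P(4) v st st' by (auto simp: w_def)
    then have y: "0 < y" "y < 1" and wy: "(1 + s - t) * y + t = w"
      using ts by (simp_all add: y_def field_simps)
    have \<gamma>w: "\<gamma> w = \<gamma> v" "velocity w = velocity v" by (simp_all add: w_def periodic velocity_periodic)
    have px: "p z = p\<^sub>1 (2 * z)" if "z < 1/2" for z using that by (simp add: p_def joinpaths_def)
    have pxu: "p x = \<gamma> u" using px[OF x(2)] mx p1 by simp
    have ry: "r y = \<gamma> v" using r_eq wy \<gamma>w by simp
    have der_p1: "(p\<^sub>1 has_vector_derivative m *\<^sub>R velocity u) (at (2 * x))"
    proof -
      have "(\<gamma> has_vector_derivative velocity u) (at ((t - \<delta> - (s + \<delta>)) * (2 * x) + (s + \<delta>)))"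
        using velocity[of u] mx by (simp add: m_def algebra_simps)
      then show ?thesis
        unfolding p\<^sub>1_def using subpath_has_vector_derivative by (fastforce simp: m_def algebra_simps)
    qed
    have "((\<lambda>z. 2 * z) has_vector_derivative 2) (at x)"
      unfolding has_real_derivative_iff_has_vector_derivative[symmetric] by (auto intro!: derivative_eq_intros)
    from vector_diff_chain_at[OF this der_p1] have "((\<lambda>z. p\<^sub>1 (2 * z)) has_vector_derivative (2 * m) *\<^sub>R velocity u) (at x)"
      by (simp add: comp_def)
    then have "(p has_vector_derivative (2 * m) *\<^sub>R velocity u) (at x)"
      by (rule has_vector_derivative_transform_within_open[of _ _ _ "{..<1/2}"]) (use x px in auto)
    moreover have "(r has_vector_derivative (1 + s - t) *\<^sub>R velocity v) (at y)"
      unfolding r_def by (rule subpath_has_vector_derivative) (use velocity[of w] wy \<gamma>w in simp)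
    ultimately show ?thesis
      using x y pxu ry eq by (simp add: \<psi> intersection_pairs_def)
  qed
  have "bij_betw \<psi> (linked s t) (intersection_pairs p r)"
    unfolding bij_betw_def
  proof
    show "inj_on \<psi> (linked s t)"
    proof (rule inj_onI, clarify)
      fix u v u' v' assume uv: "(u, v) \<in> linked s t" "(u', v') \<in> linked s t" "\<psi> (u, v) = \<psi> (u', v')"
      then have "u = u'" "(if v < s then v + 1 else v) = (if v' < s then v' + 1 else v')"
        using m ts by (auto simp: \<psi>_def)
      then show "u = u' \<and> v = v'" using uv(1,2) by (auto simp: linked_def P_iff split: if_splits)
    qed
    show "\<psi> ` linked s t = intersection_pairs p r"
    proof
      show "\<psi> ` linked s t \<subseteq> intersection_pairs p r" using point by auto
      show "intersection_pairs p r \<subseteq> \<psi> ` linked s t"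
      proof (clarify)
        fix x y assume "(x, y) \<in> intersection_pairs p r"
        then have xy: "0 \<le> x" "x \<le> 1" "0 \<le> y" "y \<le> 1" and eq: "p x = r y"
          by (auto simp: intersection_pairs_def)
        define w where "w = (1 + s - t) * y + t"
        have "(1 + s - t) * y \<le> (1 + s - t) * 1" "(1 + s - t) * y \<ge> 0"
          using xy ts by (intro mult_left_mono, auto)
        then have "w - t \<le> (1 + s - t) * 1" "w - t \<ge> 0" by (simp_all only: w_def add_diff_cancel_right')
        then have w: "w \<in> {t..1+s}" by simp
        have rw: "r y = \<gamma> w" by (simp add: r_eq w_def)
        have x2: "x < 1/2"
        proof (rule ccontr)
          assume "\<not> x < 1/2"
          have "p x = q (2 * x - 1)"
          proof (cases "x = 1/2")
            case True
            show ?thesis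
              unfolding True using ends(1) by (simp add: p_def joinpaths_def pathfinish_def pathstart_def)
          qed (use \<open>\<not> x < 1/2\<close> in \<open>auto simp: p_def joinpaths_def\<close>)
          then show False using q_avoid[of "2 * x - 1" w] xy w eq rw \<open>\<not> x < 1/2\<close> by auto
        qed
        have x0: "x \<noteq> 0"
        proof
          assume "x = 0"
          then have "p x = q 1" using ends(2) by (simp add: p_def joinpaths_def pathfinish_def pathstart_def)
          then show False using q_avoid[of 1 w] w eq rw by auto
        qed
        define u where "u = m * (2 * x) + (s + \<delta>)"
        have "0 < m * (2 * x)" "m * (2 * x) < m * 1"
          using x0 xy(1) x2 m by (auto intro!: mult_strict_left_mono)
        then have u: "s + \<delta> < u" "u < t - \<delta>" by (auto simp: u_def m_def)
        have pu: "p x = \<gamma> u" using x2 by (simp add: p_def joinpaths_def p1 u_def)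
        have "\<gamma> u \<noteq> \<gamma> s"
        proof
          assume "\<gamma> u = \<gamma> s"
          then have "(s, u) \<in> P" using u st' \<delta> st by (simp add: P_iff)
          then show False using P_unique[OF st(1)] u \<delta> by auto
        qed
        moreover have "\<gamma> (1 + s) = \<gamma> s" using periodic[of s] by (simp add: add.commute)
        ultimately have "w \<noteq> t" "w \<noteq> 1 + s" using eq rw pu st'(3) by auto
        then have w': "t < w" "w < 1 + s" using w by auto
        define v where "v = (if w < 1 then w else w - 1)"
        have "\<gamma> v = \<gamma> w" using periodic[of "w - 1"] by (simp add: v_def)
        moreover have "0 \<le> v" "v < 1" and v: "v < s \<or> t < v" using w' st' st by (auto simp: v_def)
        ultimately have "(u, v) \<in> linked s t"
          using u \<delta> st' st eq rw pu by (auto simp: linked_def P_iff)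
        moreover have "\<psi> (u, v) = (x, y)"
        proof -
          have "(if v < s then v + 1 else v) = w" using w' st' st by (auto simp: v_def)
          then show ?thesis using m ts by (simp add: \<psi>_def u_def w_def)
        qed
        ultimately show "(x, y) \<in> \<psi> ` linked s t" by force
      qed
    qed
  qed
  note bij = this
  have sgn: "local_intersection_sign N p r (fst (\<psi> z)) (snd (\<psi> z)) = sign z" if "z \<in> linked s t" for z
  proof -
    obtain u v where z: "z = (u, v)" by (cases z)
    note pt = point[OF that[unfolded z]]
    have "local_intersection_sign N p r (fst (\<psi> z)) (snd (\<psi> z)) = sgn_int (N (p (fst (\<psi> z))) \<bullet> cross3 (velocity u) (velocity v))"
      using pt m ts by (intro local_intersection_sign_scaled[of _ "2 * m" _ _ _ "1 + s - t"]) (auto simp: z)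
    then show ?thesis using pt by (simp add: z local_intersection_sign_def)
  qed
  have fin: "finite (linked s t)" by (rule finite_subset[OF _ finite_P]) (auto simp: linked_def)
  have "meet_transversally N p r"
    unfolding meet_transversally_def
  proof (intro conjI ballI)
    show "finite (intersection_pairs p r)" using bij_betw_finite[OF bij] fin by simp
    fix z assume "z \<in> intersection_pairs p r"
    then obtain z' where z': "z' \<in> linked s t" "z = \<psi> z'" using bij unfolding bij_betw_def by blast
    obtain u v where uv: "z' = (u, v)" by (cases z')
    note pt = point[OF z'(1)[unfolded uv], folded uv, folded z'(2)]
    have "sign z' \<noteq> 0" using z'(1) uv sign_nonzero[of u v] by (auto simp: linked_def)
    then have "local_intersection_sign N p r (fst z) (snd z) \<noteq> 0" using sgn[OF z'(1)] z'(2) by simp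
    then show "case z of (s, t) \<Rightarrow> s \<in> {0<..<1} \<and> t \<in> {0<..<1} \<and> p differentiable at s \<and> r differentiable at t \<and>
        local_intersection_sign N p r s t \<noteq> 0"
      using pt by (auto simp: case_prod_beta intro: differentiableI_vector)
  qed
  then have "\<iota> (loop_class S p) (loop_class S r) = (\<Sum>(s, t) \<in> intersection_pairs p r. local_intersection_sign N p r s t)"
    by (intro form_transversal vp loop_p r_loop)
  also have "\<dots> = (\<Sum>z \<in> linked s t. local_intersection_sign N p r (fst (\<psi> z)) (snd (\<psi> z)))"
    unfolding case_prod_beta using sum.reindex_bij_betw[OF bij] by (metis (no_types, lifting) sum.cong)
  also have "\<dots> = sum sign (linked s t)" using sgn by (intro sum.cong) auto
  finally show ?thesis by (simp add: class_p r_def)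
qed

end

section \<open>Derivatives at 1\<close>

lemma antisymmetric_sum_zero:
  fixes f :: "'a \<Rightarrow> 'a \<Rightarrow> 'b::linordered_idom"
  assumes "\<And>x y. x \<in> A \<Longrightarrow> y \<in> A \<Longrightarrow> f y x = - f x y"
  shows "(\<Sum>x\<in>A. \<Sum>y\<in>A. f x y) = 0"
proof -
  have "(\<Sum>x\<in>A. \<Sum>y\<in>A. f x y) = (\<Sum>y\<in>A. \<Sum>x\<in>A. f x y)" by (rule sum.swap)
  also have "\<dots> = (\<Sum>y\<in>A. \<Sum>x\<in>A. - f y x)" using assms by (intro sum.cong refl)
  finally show ?thesis by (simp add: sum_negf)
qed

lemma symmetric_sum_even:
  fixes f :: "'a \<Rightarrow> 'a \<Rightarrow> int"
  assumes "finite A" "\<And>x y. x \<in> A \<Longrightarrow> y \<in> A \<Longrightarrow> f x y = f y x" "\<And>x. x \<in> A \<Longrightarrow> f x x = 0"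
  shows "even (\<Sum>x\<in>A. \<Sum>y\<in>A. f x y)"
  using assms
proof (induction A rule: finite_induct)
  case (insert a A)
  have "(\<Sum>x\<in>A. f x a) = (\<Sum>x\<in>A. f a x)" by (rule sum.cong) (use insert.prems in auto)
  then have "(\<Sum>x\<in>insert a A. \<Sum>y\<in>insert a A. f x y) = 2 * (\<Sum>x\<in>A. f a x) + (\<Sum>x\<in>A. \<Sum>y\<in>A. f x y)"
    using insert.hyps insert.prems(2)[of a] by (simp add: sum.distrib)
  moreover have "even (\<Sum>x\<in>A. \<Sum>y\<in>A. f x y)"
    by (rule insert.IH) (use insert.prems in auto)
  ultimately show ?case by simp
qed simp

text \<open>
  The first derivative is required on all of \<open>t > 0\<close>: the second derivative at 1 is the derivative of
  the function \<open>deriv Y\<close>, which must therefore be known in a neighbourhood.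
\<close>

definition jet_at_one :: "(real \<Rightarrow> real) \<Rightarrow> real \<Rightarrow> real \<Rightarrow> bool" where
  "jet_at_one Y a b \<longleftrightarrow> (\<exists>Y'. (\<forall>t>0. (Y has_real_derivative Y' t) (at t)) \<and> Y' 1 = a \<and>
     (Y' has_real_derivative b) (at 1))"

lemma jet_at_one_deriv:
  assumes "jet_at_one Y a b"
  shows "deriv Y 1 = a" "deriv (deriv Y) 1 = b"
proof -
  obtain Y' where Y': "\<And>t. t > 0 \<Longrightarrow> (Y has_real_derivative Y' t) (at t)" "Y' 1 = a" "(Y' has_real_derivative b) (at 1)"
    using assms unfolding jet_at_one_def by blast
  have eq: "deriv Y t = Y' t" if "t > 0" for t using Y'(1)[OF that] by (rule DERIV_imp_deriv)
  show "deriv Y 1 = a" using eq[of 1] Y'(2) by simp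
  have "\<forall>\<^sub>F t in nhds 1. deriv Y t = Y' t"
    using eventually_nhds_in_open[of "{0<..}" "1::real"] by (auto elim!: eventually_mono simp: eq)
  then have "deriv (deriv Y) 1 = deriv Y' 1" by (rule deriv_cong_ev) simp
  then show "deriv (deriv Y) 1 = b" using Y'(3) by (simp add: DERIV_imp_deriv)
qed

lemma jet_at_one_powi: "jet_at_one (\<lambda>t. t powi k - 1) (of_int k) (of_int (k * (k - 1)))"
  unfolding jet_at_one_def
  by (intro exI[of _ "\<lambda>t. of_int k * t powi (k - 1)"]) (auto intro!: derivative_eq_intros)

lemma jet_at_one_powi_inverse:
  "jet_at_one (\<lambda>t. inverse t powi k - 1) (- of_int k) (of_int (k * (k + 1)))"
  using jet_at_one_powi[of "- k"] by (simp add: power_int_minus power_int_inverse algebra_simps)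

lemma jet_at_one_diff:
  assumes "jet_at_one Y a b" "jet_at_one Z c d"
  shows "jet_at_one (\<lambda>t. Y t - Z t) (a - c) (b - d)"
proof -
  obtain Y' Z' where "\<forall>t>0. (Y has_real_derivative Y' t) (at t)" "Y' 1 = a" "(Y' has_real_derivative b) (at 1)"
    "\<forall>t>0. (Z has_real_derivative Z' t) (at t)" "Z' 1 = c" "(Z' has_real_derivative d) (at 1)"
    using assms unfolding jet_at_one_def by blast
  then show ?thesis
    unfolding jet_at_one_def by (intro exI[of _ "\<lambda>t. Y' t - Z' t"]) (auto intro!: derivative_intros)
qed

lemma jet_at_one_cmult:
  assumes "jet_at_one Y a b"
  shows "jet_at_one (\<lambda>t. k * Y t) (k * a) (k * b)"
proof -
  obtain Y' where "\<forall>t>0. (Y has_real_derivative Y' t) (at t)" "Y' 1 = a" "(Y' has_real_derivative b) (at 1)"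
    using assms unfolding jet_at_one_def by blast
  then show ?thesis
    unfolding jet_at_one_def by (intro exI[of _ "\<lambda>t. k * Y' t"]) (auto intro!: DERIV_cmult)
qed

lemma jet_at_one_sum:
  assumes "\<And>x. x \<in> A \<Longrightarrow> jet_at_one (Y x) (a x) (b x)"
  shows "jet_at_one (\<lambda>t. \<Sum>x\<in>A. Y x t) (sum a A) (sum b A)"
proof -
  have "\<forall>x\<in>A. \<exists>Y'. (\<forall>t>0. (Y x has_real_derivative Y' t) (at t)) \<and> Y' 1 = a x \<and> (Y' has_real_derivative b x) (at 1)"
    using assms unfolding jet_at_one_def by blast
  then obtain Y' where Y': "\<forall>x\<in>A. (\<forall>t>0. (Y x has_real_derivative Y' x t) (at t)) \<and> Y' x 1 = a x \<and>
      (Y' x has_real_derivative b x) (at 1)"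
    by (elim bchoice[THEN exE])
  then show ?thesis
    unfolding jet_at_one_def by (intro exI[of _ "\<lambda>t. \<Sum>x\<in>A. Y' x t"]) (auto intro!: DERIV_sum)
qed

section \<open>Integer identities for the derivatives\<close>

text \<open>
  The role of the parameters: \<open>e c\<close> is the sign of the crossing \<open>c\<close>, \<open>m c\<close> is \<open>\<alpha>\<^sub>c \<cdot> \<gamma>\<close>, and \<open>x c d\<close> is
  \<open>\<alpha>\<^sub>c \<cdot> \<alpha>\<^sub>d\<close>.  Then \<open>\<alpha>\<^sub>c \<cdot> \<beta>\<^sub>d = m c - x c d\<close> and \<open>\<beta>\<^sub>c \<cdot> \<beta>\<^sub>d = m d - m c + x c d\<close>.
\<close>

locale crossing_pairing =
  fixes e m :: "'a \<Rightarrow> int" and x :: "'a \<Rightarrow> 'a \<Rightarrow> int"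
  assumes skew: "x d c = - x c d"
begin

abbreviation "weight A \<equiv> \<Sum>c\<in>A. e c"
abbreviation "moment A \<equiv> \<Sum>c\<in>A. e c * m c"
abbreviation "cross_moment A B \<equiv> \<Sum>c\<in>A. \<Sum>d\<in>B. e c * e d * x c d"

lemma cross_moment_skew: "cross_moment B A = - cross_moment A B"
proof -
  have "cross_moment B A = (\<Sum>c\<in>A. \<Sum>d\<in>B. e d * e c * x d c)" by (rule sum.swap)
  also have "\<dots> = (\<Sum>c\<in>A. \<Sum>d\<in>B. - (e c * e d * x c d))"
  proof (intro sum.cong refl)
    show "e d * e c * x d c = - (e c * e d * x c d)" for c d by (subst skew) (simp add: mult_ac)
  qed
  finally show ?thesis by (simp add: sum_negf)
qed

lemma G_first: "(\<Sum>c\<in>A. \<Sum>d\<in>B. e c * e d * (m c - x c d)) - weight B * moment A = - cross_moment A B"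
proof -
  have "(\<Sum>c\<in>A. \<Sum>d\<in>B. e c * e d * (m c - x c d)) = (\<Sum>c\<in>A. \<Sum>d\<in>B. (e c * m c) * e d) - cross_moment A B"
    by (simp add: algebra_simps flip: sum_subtractf)
  also have "(\<Sum>c\<in>A. \<Sum>d\<in>B. (e c * m c) * e d) = moment A * weight B" by (rule sum_product[symmetric])
  finally show ?thesis by simp
qed

lemma H_first: "(\<Sum>c\<in>A. \<Sum>d\<in>B. e c * e d * (m d - m c + x c d)) = weight A * moment B - moment A * weight B + cross_moment A B"
proof -
  have "(\<Sum>c\<in>A. \<Sum>d\<in>B. e c * e d * (m d - m c + x c d)) =
      (\<Sum>c\<in>A. \<Sum>d\<in>B. e c * (e d * m d)) - (\<Sum>c\<in>A. \<Sum>d\<in>B. (e c * m c) * e d) + cross_moment A B"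
    by (simp add: algebra_simps flip: sum_subtractf sum.distrib)
  then show ?thesis by (simp only: sum_product)
qed

text \<open>
  Expanding the squares turns the left side into twice the double sum of the symmetric function
  \<open>e\<^sub>c e\<^sub>d (x\<^sup>2 + x (m\<^sub>d - m\<^sub>c))\<close>, which vanishes on the diagonal and so has an even sum, plus the sum of an
  antisymmetric function, minus twice the square of the moment.  The terms \<open>e\<^sub>c e\<^sub>d (m\<^sub>c\<^sup>2 + m\<^sub>d\<^sup>2)\<close> are
  cancelled by the two sums with the factor \<open>weight A\<close>.
\<close>

lemma second_mod_four:
  assumes "finite A"
  shows "\<exists>k. (\<Sum>c\<in>A. \<Sum>d\<in>A. e c * e d * (x c d * (x c d - 1))) +
    ((\<Sum>c\<in>A. \<Sum>d\<in>A. e c * e d * ((m d - m c + x c d) * (m d - m c + x c d - 1)))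
     - weight A * (\<Sum>c\<in>A. e c * (m c * (m c - 1))) - weight A * (\<Sum>c\<in>A. e c * (m c * (m c + 1)))) =
    4 * k - 2 * (moment A)\<^sup>2"
proof -
  let ?f = "\<lambda>c d. e c * e d * (x c d * x c d + x c d * (m d - m c))"
  let ?g = "\<lambda>c d. e c * e d * (m c - m d - 2 * x c d)"
  let ?q = "\<Sum>c\<in>A. e c * (m c)\<^sup>2"
  have diag: "x c c = 0" for c using skew[of c c] by simp
  have "even (\<Sum>c\<in>A. \<Sum>d\<in>A. ?f c d)"
  proof (rule symmetric_sum_even[OF assms])
    show "?f c d = ?f d c" for c d by (subst (1 2 3) skew[of d c]) (simp add: algebra_simps)
  qed (simp add: diag)
  then obtain k where k: "(\<Sum>c\<in>A. \<Sum>d\<in>A. ?f c d) = 2 * k" by (auto elim: evenE)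
  have g: "(\<Sum>c\<in>A. \<Sum>d\<in>A. ?g c d) = 0"
  proof (rule antisymmetric_sum_zero)
    show "?g d c = - ?g c d" for c d by (subst skew[of d c]) (simp add: algebra_simps)
  qed
  have "(\<Sum>c\<in>A. \<Sum>d\<in>A. e c * e d * (x c d * (x c d - 1))) +
      (\<Sum>c\<in>A. \<Sum>d\<in>A. e c * e d * ((m d - m c + x c d) * (m d - m c + x c d - 1)))
    = (\<Sum>c\<in>A. \<Sum>d\<in>A. 2 * ?f c d + ?g c d + (e c * (m c)\<^sup>2) * e d + e c * (e d * (m d)\<^sup>2)
        - 2 * ((e c * m c) * (e d * m d)))"
    unfolding sum.distrib[symmetric]
    by (intro sum.cong refl) (simp add: algebra_simps power2_eq_square)
  also have "\<dots> = 2 * (\<Sum>c\<in>A. \<Sum>d\<in>A. ?f c d) + (\<Sum>c\<in>A. \<Sum>d\<in>A. ?g c d) + ?q * weight A + weight A * ?q - 2 * (moment A * moment A)"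
    unfolding sum.distrib sum_subtractf sum_distrib_left[symmetric, where r = 2] sum_product by simp
  finally have 1: "(\<Sum>c\<in>A. \<Sum>d\<in>A. e c * e d * (x c d * (x c d - 1))) +
      (\<Sum>c\<in>A. \<Sum>d\<in>A. e c * e d * ((m d - m c + x c d) * (m d - m c + x c d - 1)))
    = 4 * k + 2 * (weight A * ?q) - 2 * (moment A)\<^sup>2"
    by (simp add: k g power2_eq_square mult.commute)
  have "(\<Sum>c\<in>A. e c * (m c * (m c - 1))) + (\<Sum>c\<in>A. e c * (m c * (m c + 1))) = 2 * ?q"
    by (simp add: sum_distrib_left algebra_simps power2_eq_square flip: sum.distrib)
  then have "weight A * (\<Sum>c\<in>A. e c * (m c * (m c - 1))) + weight A * (\<Sum>c\<in>A. e c * (m c * (m c + 1))) = 2 * (weight A * ?q)"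
    by (simp flip: distrib_left)
  with 1 show ?thesis by (intro exI[of _ k]) linarith
qed

end

section \<open>Cancellation of linked pairs\<close>

context realized_knot
begin

text \<open>
  One pair of times for each double point, in the order of passage.
\<close>

definition "ordered_P = {z \<in> P. fst z < snd z}"

text \<open>
  A linked double point has its second passage outside \<open>[s, t]\<close> or its first one; in the second case
  the inner passage comes last and the sign is reversed.
\<close>

lemma sum_linked:
  "sum sign (linked s t) =
     (\<Sum>z \<in> ordered_P. (of_bool (s < fst z \<and> fst z < t \<and> t < snd z) - of_bool (fst z < s \<and> s < snd z \<and> snd z < t)) * sign z)"
proof -
  let ?L1 = "{z \<in> ordered_P. s < fst z \<and> fst z < t \<and> t < snd z}"
  let ?L2 = "{z \<in> ordered_P. fst z < s \<and> s < snd z \<and> snd z < t}"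
  have fin: "finite ordered_P" using finite_P by (simp add: ordered_P_def)
  have "linked s t = ?L1 \<union> prod.swap ` ?L2"
  proof (intro equalityI subsetI)
    fix z assume "z \<in> linked s t"
    then have z: "z \<in> P" "s < fst z" "fst z < t" "snd z < s \<or> t < snd z"
      by (auto simp: linked_def)
    show "z \<in> ?L1 \<union> prod.swap ` ?L2"
    proof (cases "t < snd z")
      case True then show ?thesis using z by (auto simp: ordered_P_def)
    next
      case False
      then have "prod.swap z \<in> ?L2" using z by (cases z) (auto simp: ordered_P_def P_iff)
      then have "prod.swap (prod.swap z) \<in> prod.swap ` ?L2" by (rule imageI)
      then show ?thesis by simp
    qed
  next
    fix z assume "z \<in> ?L1 \<union> prod.swap ` ?L2"
    then show "z \<in> linked s t" by (auto simp: linked_def ordered_P_def P_iff)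
  qed
  then have "sum sign (linked s t) = sum sign ?L1 + sum sign (prod.swap ` ?L2)"
  proof (simp only:, intro sum.union_disjoint)
    show "finite ?L1" "finite (prod.swap ` ?L2)" using fin by simp_all
  qed (auto simp: ordered_P_def)
  also have "sum sign (prod.swap ` ?L2) = (\<Sum>z\<in>?L2. - sign z)"
    by (subst sum.reindex) (auto intro!: sum.cong local_intersection_sign_swap simp: ordered_P_def P_iff inj_on_def)
  also have "sum sign ?L1 = (\<Sum>z\<in>ordered_P. of_bool (s < fst z \<and> fst z < t \<and> t < snd z) * sign z)"
    using fin by (simp add: sum.inter_filter of_bool_def if_distrib[of "\<lambda>k. k * _"] cong: if_cong)
  also have "(\<Sum>z\<in>?L2. - sign z) = (\<Sum>z\<in>ordered_P. - (of_bool (fst z < s \<and> s < snd z \<and> snd z < t) * sign z))"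
    using fin by (simp add: sum.inter_filter of_bool_def if_distrib[of "\<lambda>k. k * _"] if_distrib[of uminus] cong: if_cong)
  finally show ?thesis by (simp add: left_diff_distrib sum_subtractf sum_negf)
qed

text \<open>
  Two linked double points contribute twice: the one passed earlier sees the first passage of the
  other, and is itself seen by its second passage.  These contributions have opposite signs.
\<close>

lemma linked_signs_cancel: "(\<Sum>z \<in> ordered_P. sign z * sum sign (linked (fst z) (snd z))) = 0"
  unfolding sum_linked sum_distrib_left
  by (rule antisymmetric_sum_zero) (simp add: algebra_simps)

definition "alpha_loop z = loop_class S (subpath (fst z) (snd z) \<gamma>)"
definition "beta_loop z = loop_class S (subpath (snd z) (1 + fst z) \<gamma>)"

text \<open>
  The sum \<open>\<alpha> + \<beta>\<close> is the class of the knot for both crossings; the rest is bilinearity and skew-symmetry.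
\<close>

lemma alpha_beta_table:
  assumes "z \<in> P" "z' \<in> P"
  shows "\<iota> (alpha_loop z) (beta_loop z') = \<iota> (alpha_loop z) (beta_loop z) - \<iota> (alpha_loop z) (alpha_loop z')"
    and "\<iota> (beta_loop z) (beta_loop z') =
         \<iota> (alpha_loop z') (beta_loop z') - \<iota> (alpha_loop z) (beta_loop z) + \<iota> (alpha_loop z) (alpha_loop z')"
    and "\<iota> (alpha_loop z') (alpha_loop z) = - \<iota> (alpha_loop z) (alpha_loop z')"
proof -
  have loops: "loop_in S (subpath (fst y) (snd y) \<gamma>)" "loop_in S (subpath (snd y) (1 + fst y) \<gamma>)"
    if "y \<in> P" for y
  proof -
    have "\<gamma> (fst y) = \<gamma> (snd y)" "\<gamma> (snd y) = \<gamma> (1 + fst y)"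
      using that periodic[of "fst y"] by (auto simp: double_pairs_def add.commute)
    then show "loop_in S (subpath (fst y) (snd y) \<gamma>)" "loop_in S (subpath (snd y) (1 + fst y) \<gamma>)"
      using subpath_loop(2) by blast+
  qed
  have loop: "loop_in S (subpath 0 1 \<gamma>)" using subpath_loop(2)[of 0 1] periodic[of 0] by simp
  let ?K = "loop_class S (subpath 0 1 \<gamma>)"
  have split: "\<iota> ?K (loop_class S q) = \<iota> (alpha_loop y) (loop_class S q) + \<iota> (beta_loop y) (loop_class S q)"
    if "y \<in> P" "loop_in S q" for y q
    unfolding alpha_loop_def beta_loop_def
    by (rule form_loop_add[OF loops[OF that(1)] that(2) smoothing_sum])
  have skew: "\<iota> (loop_class S q) (loop_class S p) = - \<iota> (loop_class S p) (loop_class S q)"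
    if "loop_in S p" "loop_in S q" for p q by (rule form_loop_skew[OF that])
  have K: "\<iota> ?K (alpha_loop y) = \<iota> (alpha_loop y') (alpha_loop y) + \<iota> (beta_loop y') (alpha_loop y)"
    "\<iota> ?K (beta_loop y) = \<iota> (alpha_loop y') (beta_loop y) + \<iota> (beta_loop y') (beta_loop y)"
    if "y \<in> P" "y' \<in> P" for y y'
    using split[OF that(2) loops(1)[OF that(1)]] split[OF that(2) loops(2)[OF that(1)]]
    by (simp_all add: alpha_loop_def beta_loop_def)
  have sk: "\<iota> (alpha_loop y) (alpha_loop y') = - \<iota> (alpha_loop y') (alpha_loop y)"
    "\<iota> (beta_loop y) (beta_loop y') = - \<iota> (beta_loop y') (beta_loop y)"
    "\<iota> (alpha_loop y) (beta_loop y') = - \<iota> (beta_loop y') (alpha_loop y)"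
    if "y \<in> P" "y' \<in> P" for y y'
    unfolding alpha_loop_def beta_loop_def by (intro skew loops that)+
  note facts = K[OF assms(1) assms(1)] K[OF assms(1) assms(2)] K[OF assms(2) assms(1)] K[OF assms(2) assms(2)]
    sk[OF assms(1) assms(1)] sk[OF assms(1) assms(2)] sk[OF assms(2) assms(1)] sk[OF assms(2) assms(2)]
  show "\<iota> (alpha_loop z) (beta_loop z') = \<iota> (alpha_loop z) (beta_loop z) - \<iota> (alpha_loop z) (alpha_loop z')"
    using facts by linarith
  show "\<iota> (beta_loop z) (beta_loop z') =
         \<iota> (alpha_loop z') (beta_loop z') - \<iota> (alpha_loop z) (beta_loop z) + \<iota> (alpha_loop z) (alpha_loop z')"
    using facts by linarith
  show "\<iota> (alpha_loop z') (alpha_loop z) = - \<iota> (alpha_loop z) (alpha_loop z')"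
    using sk(1)[OF assms(2,1)] .
qed

end

section \<open>Relations between the derivatives\<close>

lemma knot_diagram_valid:
  assumes "K \<in> long_virtual_knots" "D \<in> K"
  shows "long_virtual_knot_diagram D"
  using assms by (auto simp: long_virtual_knots_def quotient_def)

lemma plane_crossing_sign_nonzero:
  fixes p q :: "real^2"
  assumes "\<And>x y. x *\<^sub>R p + y *\<^sub>R q = 0 \<Longrightarrow> x = 0 \<and> y = 0"
  shows "p$1 * q$2 - p$2 * q$1 \<noteq> 0"
proof
  assume det: "p$1 * q$2 - p$2 * q$1 = 0"
  have "q$2 *\<^sub>R p + (- p$2) *\<^sub>R q = 0" "q$1 *\<^sub>R p + (- p$1) *\<^sub>R q = 0"
    using det by (auto simp: vec_eq_iff forall_2 algebra_simps)
  from assms[OF this(1)] assms[OF this(2)] have "p = 0" by (simp add: vec_eq_iff forall_2)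
  then show False using assms[of 1 0] by simp
qed

lemma crossing_sign_nonzero:
  assumes D: "long_virtual_knot_diagram D" and c: "c \<in> crossings D"
  shows "crossing_sign D c \<noteq> 0"
proof -
  have "c \<in> double_pairs UNIV (line D)"
    using D c by (auto simp: long_virtual_knot_diagram_def crossing_information_def)
  moreover define p q where "p = vector_derivative (line D) (at (fst c))" "q = vector_derivative (line D) (at (snd c))"
  ultimately have "x = 0 \<and> y = 0" if "x *\<^sub>R p + y *\<^sub>R q = 0" for x y
    using that D unfolding long_virtual_knot_diagram_def transversal_double_points_def by fastforce
  then have "p$1 * q$2 - p$2 * q$1 \<noteq> 0" by (rule plane_crossing_sign_nonzero)
  then show ?thesis
    by (simp add: crossing_sign_def Let_def sgn_int_def flip: p_q_def)
qed

definition smoothing_pair :: "realization \<Rightarrow> real \<times> real \<Rightarrow> real \<times> real" where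
  "smoothing_pair R c = (first_passage R c, second_passage R c)"

theorem theorem10p3:
  fixes K :: "long_diagram set" and D :: long_diagram and R :: realization and \<iota> :: pairing
  assumes "K \<in> long_virtual_knots"
    and "D \<in> K"
    and "surface_realization D R"
    and "intersection_form (surface R) (unit_normal R) \<iota>"
  shows "deriv (W_poly D R \<iota> 0) 1 = deriv (W_poly D R \<iota> 1) 1
    \<and> (deriv (G_poly D R \<iota> 0 0) 1 = 0 \<and> deriv (G_poly D R \<iota> 1 1) 1 = 0)
    \<and> deriv (G_poly D R \<iota> 0 1) 1 + deriv (G_poly D R \<iota> 1 0) 1 = 0
    \<and> (deriv (F_poly D R \<iota> 0 1) 1 = deriv (H_poly D R \<iota> 0 1) 1
       \<and> deriv (F_poly D R \<iota> 1 0) 1 = deriv (H_poly D R \<iota> 1 0) 1)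
    \<and> (\<exists>m::int. deriv (deriv (F_poly D R \<iota> 0 0)) 1 + deriv (deriv (F_poly D R \<iota> 1 1)) 1
                + deriv (deriv (H_poly D R \<iota> 0 0)) 1 + deriv (deriv (H_poly D R \<iota> 1 1)) 1
              = 4 * of_int m)"
proof -
  define h where "h = passage R"
  define X where "X = crossings D"
  have D: "long_virtual_knot_diagram D" using knot_diagram_valid assms(1,2) .
  have "finite (double_pairs UNIV (line D))" "X \<subseteq> double_pairs UNIV (line D)"
    and asym: "\<And>o' u. (o', u) \<in> X \<Longrightarrow> (u, o') \<notin> X"
    using D by (auto simp: X_def long_virtual_knot_diagram_def transversal_double_points_def crossing_information_def)
  then have finX: "finite X" and neq: "\<And>o' u. (o', u) \<in> X \<Longrightarrow> o' \<noteq> u"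
    using finite_subset by (auto simp: double_pairs_def)
  have diagram: "surface_knot_diagram R" and real_only: "no_virtual_crossings R"
    and mono: "strict_mono_on (fst ` X \<union> snd ` X) h"
    and image: "knot_crossings R = map_prod h h ` X"
    and signs: "\<And>o' u. (o', u) \<in> X \<Longrightarrow> crossing_sign D (o', u) =
          local_intersection_sign (unit_normal R) (knot R) (knot R) (h o') (h u)"
    using assms(3) by (auto simp: surface_realization_def X_def h_def)
  have mem: "o' \<in> fst ` X \<union> snd ` X" "u \<in> fst ` X \<union> snd ` X" if "(o', u) \<in> X" for o' u
    using that by force+
  have h_less: "h a < h b \<longleftrightarrow> a < b" and h_eq: "h a = h b \<longleftrightarrow> a = b"
    if "a \<in> fst ` X \<union> snd ` X" "b \<in> fst ` X \<union> snd ` X" for a b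
    using strict_mono_onD[OF mono, of a b] strict_mono_onD[OF mono, of b a] that
    by (metis less_asym less_linear order_less_irrefl)+
  have h_order: "h o' < h u \<longleftrightarrow> o' < u" "h u < h o' \<longleftrightarrow> u < o'" if "(o', u) \<in> X" for o' u
    by (rule h_less[OF mem[OF that]], rule h_less[OF mem(2)[OF that] mem(1)[OF that]])
  have P_image: "map_prod h h ` X \<subseteq> double_pairs {0..<1} (knot R)"
    using diagram by (simp add: surface_knot_diagram_def crossing_information_def image)
  have P_sym: "(b, a) \<in> double_pairs {0..<1} (knot R)" if "(a, b) \<in> double_pairs {0..<1} (knot R)" for a b
    using that by (auto simp: double_pairs_def)
  have P_cases: "\<exists>o' u. (o', u) \<in> X \<and> ((a, b) = (h o', h u) \<or> (a, b) = (h u, h o'))"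
    if "(a, b) \<in> double_pairs {0..<1} (knot R)" for a b
    using real_only that unfolding no_virtual_crossings_def image by fastforce
  interpret realized_knot R \<iota>
  proof
    fix a b assume ab: "(a, b) \<in> double_pairs {0..<1} (knot R)"
    then obtain o' u where ou: "(o', u) \<in> X" "(a, b) = (h o', h u) \<or> (a, b) = (h u, h o')"
      using P_cases by blast
    have "knot R a = knot R b" using ab by (simp add: double_pairs_def)
    then have "local_intersection_sign (unit_normal R) (knot R) (knot R) a b \<in> {crossing_sign D (o', u), - crossing_sign D (o', u)}"
      using ou(2) signs[OF ou(1)] local_intersection_sign_swap[of "knot R" b a "unit_normal R"] by auto
    then show "local_intersection_sign (unit_normal R) (knot R) (knot R) a b \<noteq> 0"
      using crossing_sign_nonzero[OF D, of "(o', u)"] ou(1) by (auto simp: X_def)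
  qed (use diagram assms(4) in auto)
  define \<pi> where "\<pi> = smoothing_pair R"
  have \<pi>: "\<pi> (o', u) = (if o' < u then (h o', h u) else (h u, h o'))" for o' u
    by (simp add: \<pi>_def smoothing_pair_def first_passage_def second_passage_def h_def)
  \<comment> \<open>Every double point on the surface comes from exactly one crossing, since there are no virtual crossings.\<close>
  have bij: "bij_betw \<pi> X ordered_P"
    unfolding bij_betw_def
  proof
    show "inj_on \<pi> X"
    proof (rule inj_onI, clarify)
      fix o\<^sub>1 u\<^sub>1 o\<^sub>2 u\<^sub>2
      assume 1: "(o\<^sub>1, u\<^sub>1) \<in> X" and 2: "(o\<^sub>2, u\<^sub>2) \<in> X" and eq: "\<pi> (o\<^sub>1, u\<^sub>1) = \<pi> (o\<^sub>2, u\<^sub>2)"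
      from eq have "(o\<^sub>2, u\<^sub>2) = (o\<^sub>1, u\<^sub>1) \<or> (o\<^sub>2, u\<^sub>2) = (u\<^sub>1, o\<^sub>1)"
        using h_eq mem[OF 1] mem[OF 2] by (simp add: \<pi> split: if_splits)
      then show "o\<^sub>1 = o\<^sub>2 \<and> u\<^sub>1 = u\<^sub>2" using asym[OF 1] 2 by auto
    qed
    show "\<pi> ` X = ordered_P"
    proof (intro equalityI subsetI)
      fix z assume "z \<in> \<pi> ` X"
      then obtain o' u where ou: "(o', u) \<in> X" "z = \<pi> (o', u)" by auto
      then have "(h o', h u) \<in> P" using P_image by force
      then show "z \<in> ordered_P"
        using P_sym[of "h o'" "h u"] h_order[OF ou(1)] neq[OF ou(1)] by (auto simp: ou(2) \<pi> ordered_P_def)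
    next
      fix z assume z: "z \<in> ordered_P"
      then obtain o' u where ou: "(o', u) \<in> X" "z = (h o', h u) \<or> z = (h u, h o')"
        using P_cases[of "fst z" "snd z"] by (auto simp: ordered_P_def)
      have "fst z < snd z" using z by (simp add: ordered_P_def)
      with ou(2) h_order[OF ou(1)] have "z = \<pi> (o', u)" unfolding \<pi> by (elim disjE) simp_all
      then show "z \<in> \<pi> ` X" using ou(1) by blast
    qed
  qed
  have \<pi>P: "\<pi> c \<in> P" if "c \<in> X" for c
    using bij that by (auto simp: bij_betw_def ordered_P_def)
  define e where "e = crossing_sign D"
  \<comment> \<open>The value 0 outside \<open>X\<close> makes \<open>x\<close> skew everywhere.\<close>
  define x where "x = (\<lambda>c d. if c \<in> X \<and> d \<in> X then \<iota> (alpha R c) (alpha R d) else 0)"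
  define m where "m = (\<lambda>c. \<iota> (alpha R c) (beta R c))"
  have loops: "alpha R c = alpha_loop (\<pi> c)" "beta R c = beta_loop (\<pi> c)" for c
    by (simp_all add: alpha_def beta_def alpha_loop_def beta_loop_def \<pi>_def smoothing_pair_def)
  have \<alpha>\<alpha>: "\<iota> (alpha R c) (alpha R d) = x c d" and \<alpha>\<beta>: "\<iota> (alpha R c) (beta R d) = m c - x c d"
    and \<beta>\<beta>: "\<iota> (beta R c) (beta R d) = m d - m c + x c d" if "c \<in> X" "d \<in> X" for c d
    using alpha_beta_table(1,2)[OF \<pi>P[OF that(1)] \<pi>P[OF that(2)]] that by (simp_all add: x_def m_def loops)
  interpret crossing_pairing e m x
  proof
    show "x d c = - x c d" for c d
      using alpha_beta_table(3)[OF \<pi>P \<pi>P, of c d] by (simp add: x_def loops)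
  qed
  define Y where "Y = crossings_of_type D"
  have Y: "Y a \<subseteq> X" "finite (Y a)" for a using finX by (auto simp: Y_def X_def crossings_of_type_def)
  have types: "X = Y 0 \<union> Y 1" "Y 0 \<inter> Y 1 = {}"
    by (auto simp: X_def Y_def crossings_of_type_def crossing_type_def)
  have M: "moment (Y 0) = moment (Y 1)"
  proof -
    \<comment> \<open>The crossing sign compares over with under, \<open>sign\<close> the first passage with the second; they agree for type 0 and differ for type 1.\<close>
    have \<sigma>: "sign (\<pi> c) = (if c \<in> Y 0 then e c else - e c)" if "c \<in> X" for c
    proof -
      obtain o' u where c: "c = (o', u)" by (cases c)
      have "knot R (h o') = knot R (h u)" using P_image that c by (force simp: double_pairs_def)
      then show ?thesis
        using signs[of o' u] that local_intersection_sign_swap[of "knot R" "h o'" "h u" "unit_normal R"]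
        by (simp add: c \<pi> e_def Y_def crossings_of_type_def crossing_type_def X_def)
    qed
    have m_sum: "m c = sum sign (linked (fst (\<pi> c)) (snd (\<pi> c)))" if "c \<in> X" for c
    proof -
      have "\<pi> c \<in> ordered_P" using bij that by (auto simp: bij_betw_def)
      then show ?thesis
        using smoothing_intersection[of "fst (\<pi> c)" "snd (\<pi> c)"]
        by (simp add: m_def loops alpha_loop_def beta_loop_def ordered_P_def)
    qed
    have "0 = (\<Sum>z \<in> ordered_P. sign z * sum sign (linked (fst z) (snd z)))"
      by (rule linked_signs_cancel[symmetric])
    also have "\<dots> = (\<Sum>c\<in>X. sign (\<pi> c) * sum sign (linked (fst (\<pi> c)) (snd (\<pi> c))))"
      by (rule sum.reindex_bij_betw[OF bij, symmetric])
    also have "\<dots> = (\<Sum>c\<in>X. (if c \<in> Y 0 then e c else - e c) * m c)"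
      by (intro sum.cong refl) (simp only: \<sigma> m_sum)
    also have "\<dots> = (\<Sum>c\<in>Y 0. (if c \<in> Y 0 then e c else - e c) * m c) + (\<Sum>c\<in>Y 1. (if c \<in> Y 0 then e c else - e c) * m c)"
      unfolding types(1) by (rule sum.union_disjoint) (use Y types(2) in auto)
    also have "(\<Sum>c\<in>Y 1. (if c \<in> Y 0 then e c else - e c) * m c) = (\<Sum>c\<in>Y 1. - (e c * m c))"
      by (intro sum.cong refl) (use types(2) in auto)
    finally show ?thesis by (simp add: sum_negf)
  qed
  have W: "W_poly D R \<iota> a = (\<lambda>t. \<Sum>c\<in>Y a. of_int (e c) * (t powi m c - 1))" for a
    by (simp add: W_poly_def[abs_def] Y_def e_def m_def)
  have jet_W: "jet_at_one (W_poly D R \<iota> a) (of_int (moment (Y a))) (of_int (\<Sum>c\<in>Y a. e c * (m c * (m c - 1))))" for a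
    unfolding W of_int_sum of_int_mult[of "e _"]
    by (intro jet_at_one_sum jet_at_one_cmult jet_at_one_powi)
  have jet_W_inverse: "jet_at_one (\<lambda>t. W_poly D R \<iota> a (inverse t)) (- of_int (moment (Y a)))
         (of_int (\<Sum>c\<in>Y a. e c * (m c * (m c + 1))))" for a
    unfolding W of_int_sum of_int_mult[of "e _"] sum_negf[symmetric] mult_minus_right[symmetric]
    by (intro jet_at_one_sum jet_at_one_cmult jet_at_one_powi_inverse)
  have jet_double: "jet_at_one (\<lambda>t. \<Sum>c\<in>Y a. \<Sum>d\<in>Y b. of_int (e c * e d) * (t powi k c d - 1))
      (of_int (\<Sum>c\<in>Y a. \<Sum>d\<in>Y b. e c * e d * k c d))
      (of_int (\<Sum>c\<in>Y a. \<Sum>d\<in>Y b. e c * e d * (k c d * (k c d - 1))))" for a b and k :: "_ \<Rightarrow> _ \<Rightarrow> int"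
    unfolding of_int_sum of_int_mult[of "e _ * e _"]
    by (intro jet_at_one_sum jet_at_one_cmult jet_at_one_powi)
  have F: "F_poly D R \<iota> a b = (\<lambda>t. \<Sum>c\<in>Y a. \<Sum>d\<in>Y b. of_int (e c * e d) * (t powi x c d - 1))" for a b
    unfolding F_poly_def Y_def[symmetric] e_def[symmetric]
    by (intro ext sum.cong refl) (auto simp: \<alpha>\<alpha> dest!: subsetD[OF Y(1)])
  have G: "G_poly D R \<iota> a b = (\<lambda>t. (\<Sum>c\<in>Y a. \<Sum>d\<in>Y b. of_int (e c * e d) * (t powi (m c - x c d) - 1))
      - of_int (weight (Y b)) * W_poly D R \<iota> a t)" for a b
    unfolding G_poly_def writhe_def Y_def[symmetric] e_def[symmetric]
    by (intro ext arg_cong2[of _ _ _ _ "(-)"] sum.cong refl) (auto simp: \<alpha>\<beta> dest!: subsetD[OF Y(1)])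
  have H: "H_poly D R \<iota> a b = (\<lambda>t. (\<Sum>c\<in>Y a. \<Sum>d\<in>Y b. of_int (e c * e d) * (t powi (m d - m c + x c d) - 1))
      - of_int (weight (Y a)) * W_poly D R \<iota> b t - of_int (weight (Y b)) * W_poly D R \<iota> a (inverse t))" for a b
    unfolding H_poly_def writhe_def Y_def[symmetric] e_def[symmetric]
    by (intro ext arg_cong2[of _ _ _ _ "(-)"] sum.cong refl) (auto simp: \<beta>\<beta> dest!: subsetD[OF Y(1)])
  have jet_G: "jet_at_one (G_poly D R \<iota> a b)
      (of_int (\<Sum>c\<in>Y a. \<Sum>d\<in>Y b. e c * e d * (m c - x c d)) - of_int (weight (Y b)) * of_int (moment (Y a)))
      (of_int (\<Sum>c\<in>Y a. \<Sum>d\<in>Y b. e c * e d * ((m c - x c d) * (m c - x c d - 1)))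
        - of_int (weight (Y b)) * of_int (\<Sum>c\<in>Y a. e c * (m c * (m c - 1))))" for a b
    unfolding G by (rule jet_at_one_diff[OF jet_double[where k = "\<lambda>c d. m c - x c d"] jet_at_one_cmult[OF jet_W]])
  have jet_H: "jet_at_one (H_poly D R \<iota> a b)
      (of_int (\<Sum>c\<in>Y a. \<Sum>d\<in>Y b. e c * e d * (m d - m c + x c d))
        - of_int (weight (Y a)) * of_int (moment (Y b)) - of_int (weight (Y b)) * (- of_int (moment (Y a))))
      (of_int (\<Sum>c\<in>Y a. \<Sum>d\<in>Y b. e c * e d * ((m d - m c + x c d) * (m d - m c + x c d - 1)))
        - of_int (weight (Y a)) * of_int (\<Sum>c\<in>Y b. e c * (m c * (m c - 1)))
        - of_int (weight (Y b)) * of_int (\<Sum>c\<in>Y a. e c * (m c * (m c + 1))))" for a b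
    unfolding H
    by (rule jet_at_one_diff[OF jet_at_one_diff[OF jet_double[where k = "\<lambda>c d. m d - m c + x c d"]
          jet_at_one_cmult[OF jet_W]] jet_at_one_cmult[OF jet_W_inverse]])
  note F_jet = jet_at_one_deriv[OF jet_double[where k = x], folded F]
  note G_jet = jet_at_one_deriv[OF jet_G]
  note H_jet = jet_at_one_deriv[OF jet_H]
  have F1: "deriv (F_poly D R \<iota> a b) 1 = of_int (cross_moment (Y a) (Y b))" for a b by (rule F_jet)
  have G1: "deriv (G_poly D R \<iota> a b) 1 = - of_int (cross_moment (Y a) (Y b))" for a b
    by (simp only: G_jet(1) of_int_diff of_int_mult flip: G_first of_int_minus)
  have H1: "deriv (H_poly D R \<iota> a b) 1 = of_int (cross_moment (Y a) (Y b))" for a b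
    by (simp only: H_jet(1) H_first) simp
  have FH2: "\<exists>k. deriv (deriv (F_poly D R \<iota> a a)) 1 + deriv (deriv (H_poly D R \<iota> a a)) 1
      = of_int (4 * k - 2 * (moment (Y a))\<^sup>2)" for a
  proof -
    from second_mod_four[OF Y(2)[of a]] obtain k where k:
      "(\<Sum>c\<in>Y a. \<Sum>d\<in>Y a. e c * e d * (x c d * (x c d - 1))) +
       ((\<Sum>c\<in>Y a. \<Sum>d\<in>Y a. e c * e d * ((m d - m c + x c d) * (m d - m c + x c d - 1)))
        - weight (Y a) * (\<Sum>c\<in>Y a. e c * (m c * (m c - 1))) - weight (Y a) * (\<Sum>c\<in>Y a. e c * (m c * (m c + 1))))
       = 4 * k - 2 * (moment (Y a))\<^sup>2" ..
    show ?thesis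
      unfolding F_jet(2) H_jet(2) using arg_cong[OF k, of real_of_int]
      by (intro exI[of _ k]) (simp only: of_int_add of_int_diff of_int_mult)
  qed
  obtain k0 k1 where k: "deriv (deriv (F_poly D R \<iota> 0 0)) 1 + deriv (deriv (H_poly D R \<iota> 0 0)) 1 = of_int (4 * k0 - 2 * (moment (Y 0))\<^sup>2)"
     "deriv (deriv (F_poly D R \<iota> 1 1)) 1 + deriv (deriv (H_poly D R \<iota> 1 1)) 1 = of_int (4 * k1 - 2 * (moment (Y 1))\<^sup>2)"
    using FH2[of 0] FH2[of 1] by blast
  have diag: "cross_moment (Y a) (Y a) = 0" for a using cross_moment_skew[of "Y a" "Y a"] by simp
  show ?thesis
  proof (intro conjI)
    show "deriv (W_poly D R \<iota> 0) 1 = deriv (W_poly D R \<iota> 1) 1"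
      by (simp only: jet_at_one_deriv(1)[OF jet_W] M)
    show "deriv (G_poly D R \<iota> 0 0) 1 = 0" "deriv (G_poly D R \<iota> 1 1) 1 = 0" by (simp_all only: G1 diag of_int_0 minus_zero)
    show "deriv (G_poly D R \<iota> 0 1) 1 + deriv (G_poly D R \<iota> 1 0) 1 = 0"
      unfolding G1 cross_moment_skew[of "Y 0" "Y 1"] by simp
    show "deriv (F_poly D R \<iota> 0 1) 1 = deriv (H_poly D R \<iota> 0 1) 1"
      "deriv (F_poly D R \<iota> 1 0) 1 = deriv (H_poly D R \<iota> 1 0) 1" by (simp_all only: F1 H1)
    show "\<exists>m::int. deriv (deriv (F_poly D R \<iota> 0 0)) 1 + deriv (deriv (F_poly D R \<iota> 1 1)) 1
                + deriv (deriv (H_poly D R \<iota> 0 0)) 1 + deriv (deriv (H_poly D R \<iota> 1 1)) 1 = 4 * of_int m"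
    proof
      have sum: "x\<^sub>0 + x\<^sub>1 + y\<^sub>0 + y\<^sub>1 = 4 * of_int (k0 + k1 - v)"
        if "x\<^sub>0 + y\<^sub>0 = of_int (4 * k0 - 2 * v)" "x\<^sub>1 + y\<^sub>1 = of_int (4 * k1 - 2 * v)"
        for x\<^sub>0 x\<^sub>1 y\<^sub>0 y\<^sub>1 :: real and v
        using that by simp
      show "deriv (deriv (F_poly D R \<iota> 0 0)) 1 + deriv (deriv (F_poly D R \<iota> 1 1)) 1
                + deriv (deriv (H_poly D R \<iota> 0 0)) 1 + deriv (deriv (H_poly D R \<iota> 1 1)) 1
              = 4 * of_int (k0 + k1 - (moment (Y 1))\<^sup>2)"
        by (rule sum[OF k[unfolded M]])
    qed
  qed
qed

end
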